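(* Let $n\ge 1$ and $u,w\in\mathfrak{W}_n$. If $\mathcal{M}(u)=\mathcal{M}(w)$, then $u\sim_{cid} w$.
   Context: Partitions are Young diagrams in English notation; box $(i,j)$ is in row $i$ from the top, column $j$ from the left. For $\lambda\subseteq\mu$, $\mathrm{Inc}(\mu/\lambda)$ is the set of fillings of $\mu/\lambda$ by positive integers strictly increasing along rows (left to right) and columns (top to bottom). $\sigma_n=(n,n-1,\dots,1)$; $M_n\in\mathrm{Inc}(\sigma_n)$ has entry $i+j-1$ in box $(i,j)$ ($M_0$ empty). An inner corner of $\mu/\lambda$ is a box of $\lambda$ with no box of $\lambda$ immediately right of or below it; an outer corner of $\mu/\lambda$ is a box not in $\mu$ such that the box immediately above it and the box immediately to its left are each either in $\mu$ or outside the positive quadrant. For $T\in\mathrm{Inc}(\mu/\lambda)$ and a set $B$ of inner corners, $\mathrm{jdt}_B(T)$: put a dot in each box of $B$; for $i=1,2,\dots$ up to the largest entry, simultaneously replace each dot having a box containing $i$ immediately below or immediately right of it by $i$, and each such box containing $i$ by a dot; then delete the dots. For $S$ with largest entry $k$ and a set $C$ of outer corners, $\mathrm{rjdt}_C(S)$: put dots in $C$; for $i=k,k-1,\dots,1$, simultaneously replace each dot having a box containing $i$ immediately above or immediately left of it by $i$, and each such box containing $i$ by a dot; then delete the dots. For $T\in\mathrm{Inc}(\lambda)$ with largest entry $k$ and $U\in\mathrm{Inc}(\mu/\lambda)$: with $B_i$ the boxes of $T$ containing $i$, set $U_k=U$, $U_{i-1}=\mathrm{jdt}_{B_i}(U_i)$,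 $\mathrm{jdt}_T(U)=U_0$; with $k'$ the largest entry of $U$ and $C_i$ the boxes of $U$ containing $i$, set $T_1=T$, $T_{i+1}=\mathrm{rjdt}_{C_i}(T_i)$ for $i=1,\dots,k'$, $\mathrm{rjdt}_U(T)=T_{k'+1}$. The K-infusion is $\mathrm{infusion}(T,U)=(\mathrm{jdt}_T(U),\mathrm{rjdt}_U(T))$. $\mathfrak{W}_n$ is the set of words of length $n$ in positive integers; $w\in\mathfrak{W}_n$ is identified with the tableau of shape $\sigma_n/\sigma_{n-1}$ with $w_i$ in box $(n+1-i,i)$. Define $(\mathcal{W}(w),\mathcal{M}(w))=\mathrm{infusion}(M_{n-1},w)$. For a word $x$, $\mathrm{lis}(x)$, $\mathrm{lds}(x)$ are the lengths of a longest strictly increasing, resp. strictly decreasing, subsequence. For $u,w\in\mathfrak{W}_n$, $u\sim_{cid}w$ means that for all $1\le i\le j\le n$, $\mathrm{lis}(u_i\cdots u_j)=\mathrm{lis}(w_i\cdots w_j)$ and $\mathrm{lds}(u_i\cdots u_j)=\mathrm{lds}(w_i\cdots w_j)$. *)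

theory Defs
  imports Main "HOL-Library.Sublist"
begin

text \<open>
  A box \<open>(r, c)\<close> lies in row \<open>r\<close> from the top and column \<open>c\<close> from the left, both counted from 1.
  A tableau is a partial function whose domain is its (skew) shape.
\<close>

type_synonym box = "nat \<times> nat"
type_synonym tableau = "box \<rightharpoonup> nat"

text \<open>
  Fillings of a set of boxes by positive integers.  Since a skew shape contains every box lying
  weakly between two of its boxes, comparing adjacent boxes only is the same as comparing any two
  boxes of a row or column; we compare any two.
\<close>

definition Inc :: "box set \<Rightarrow> tableau set" where
  "Inc S = {T. dom T = S \<and> (\<forall>x \<in> ran T. 0 < x) \<and>
     (\<forall>r c c' x y. c < c' \<and> T (r, c) = Some x \<and> T (r, c') = Some y \<longrightarrow> x < y) \<and>
     (\<forall>r r' c x y. r < r' \<and> T (r, c) = Some x \<and> T (r', c) = Some y \<longrightarrow> x < y)}"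

text \<open>\<open>0\<close> for the empty tableau, so that the loops below are then empty.\<close>

definition max_entry :: "tableau \<Rightarrow> nat" where
  "max_entry T = Max (insert 0 (ran T))"

definition boxes_of :: "tableau \<Rightarrow> nat \<Rightarrow> box set" where
  "boxes_of T i = {b. T b = Some i}"

datatype cell = Dot | Entry nat

definition put_dots :: "box set \<Rightarrow> tableau \<Rightarrow> (box \<rightharpoonup> cell)" where
  "put_dots B T = (\<lambda>b. if b \<in> B then Some Dot else map_option Entry (T b))"

definition delete_dots :: "(box \<rightharpoonup> cell) \<Rightarrow> tableau" where
  "delete_dots F = (\<lambda>b. case F b of Some (Entry x) \<Rightarrow> Some x | _ \<Rightarrow> None)"

definition below_or_right :: "box \<Rightarrow> box \<Rightarrow> bool" where
  "below_or_right b b' \<longleftrightarrow> b' = (Suc (fst b), snd b) \<or> b' = (fst b, Suc (snd b))"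

text \<open>
  \<open>N d b\<close> says that \<open>b\<close> is one of the relevant neighbours of \<open>d\<close>.  All replacements are decided
  by \<open>F\<close>, the filling before the step, so they are simultaneous.
\<close>

definition swap_dots :: "(box \<Rightarrow> box \<Rightarrow> bool) \<Rightarrow> nat \<Rightarrow> (box \<rightharpoonup> cell) \<Rightarrow> (box \<rightharpoonup> cell)" where
  "swap_dots N i F = (\<lambda>b.
     if F b = Some Dot \<and> (\<exists>b'. N b b' \<and> F b' = Some (Entry i)) then Some (Entry i)
     else if F b = Some (Entry i) \<and> (\<exists>d. N d b \<and> F d = Some Dot) then Some Dot
     else F b)"

text \<open>
  The slides are total functions; they are meant for a set of inner corners (for \<open>jdt\<close>) or outer
  corners (for \<open>rjdt\<close>) of the shape of an increasing tableau.  The list \<open>[1..<Suc k]\<close> is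
  \<open>1, \<dots>, k\<close>, and \<open>fold\<close> processes its list from left to right.
\<close>

definition jdt :: "box set \<Rightarrow> tableau \<Rightarrow> tableau" where
  "jdt B T = delete_dots
     (fold (swap_dots below_or_right) [1..<Suc (max_entry T)] (put_dots B T))"

definition rjdt :: "box set \<Rightarrow> tableau \<Rightarrow> tableau" where
  "rjdt C S = delete_dots
     (fold (swap_dots (\<lambda>d b. below_or_right b d)) (rev [1..<Suc (max_entry S)]) (put_dots C S))"

definition jdt_tableau :: "tableau \<Rightarrow> tableau \<Rightarrow> tableau" where
  "jdt_tableau T U = fold (\<lambda>i. jdt (boxes_of T i)) (rev [1..<Suc (max_entry T)]) U"

definition rjdt_tableau :: "tableau \<Rightarrow> tableau \<Rightarrow> tableau" where
  "rjdt_tableau U T = fold (\<lambda>i. rjdt (boxes_of U i)) [1..<Suc (max_entry U)] T"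

definition infusion :: "tableau \<Rightarrow> tableau \<Rightarrow> tableau \<times> tableau" where
  "infusion T U = (jdt_tableau T U, rjdt_tableau U T)"

text \<open>The Young diagram of \<open>(n, n - 1, \<dots>, 1)\<close>: row \<open>r\<close> has \<open>n + 1 - r\<close> boxes.\<close>

definition staircase :: "nat \<Rightarrow> box set" where
  "staircase n = {(r, c). 1 \<le> r \<and> r \<le> n \<and> 1 \<le> c \<and> c \<le> n + 1 - r}"

definition min_tableau :: "nat \<Rightarrow> tableau" where
  "min_tableau n = (\<lambda>(r, c). if (r, c) \<in> staircase n then Some (r + c - 1) else None)"

definition words :: "nat \<Rightarrow> nat list set" where
  "words n = {w. length w = n \<and> (\<forall>x \<in> set w. 0 < x)}"

text \<open>
  The boxes of the shape are \<open>(n + 1 - i, i)\<close> for \<open>1 \<le> i \<le> n\<close>, where \<open>n = length w\<close>; the \<open>i\<close>-th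
  letter is \<open>w ! (i - 1)\<close> because list positions are counted from 0.
\<close>

definition word_tableau :: "nat list \<Rightarrow> tableau" where
  "word_tableau w = (\<lambda>(r, c).
     if (r, c) \<in> staircase (length w) - staircase (length w - 1) then Some (w ! (c - 1)) else None)"

definition word_W :: "nat list \<Rightarrow> tableau" where
  "word_W w = fst (infusion (min_tableau (length w - 1)) (word_tableau w))"

definition word_M :: "nat list \<Rightarrow> tableau" where
  "word_M w = snd (infusion (min_tableau (length w - 1)) (word_tableau w))"

definition lis :: "nat list \<Rightarrow> nat" where
  "lis x = Max (length ` {s. subseq s x \<and> sorted_wrt (<) s})"

definition lds :: "nat list \<Rightarrow> nat" where
  "lds x = Max (length ` {s. subseq s x \<and> sorted_wrt (>) s})"

text \<open>The consecutive letters \<open>w\<^sub>i \<dots> w\<^sub>j\<close>, with letters counted from 1.\<close>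

definition factor :: "nat \<Rightarrow> nat \<Rightarrow> nat list \<Rightarrow> nat list" where
  "factor i j w = drop (i - 1) (take j w)"

text \<open>The relation \<open>u \<sim> w\<close> (cid) on words of length \<open>n\<close>.\<close>

definition cid_equiv :: "nat \<Rightarrow> nat list \<Rightarrow> nat list \<Rightarrow> bool" where
  "cid_equiv n u w \<longleftrightarrow> (\<forall>i j. 1 \<le> i \<and> i \<le> j \<and> j \<le> n \<longrightarrow>
     lis (factor i j u) = lis (factor i j w) \<and> lds (factor i j u) = lds (factor i j w))"

text \<open>The tableaux to which the infusion is applied are increasing tableaux of the intended shapes.\<close>

lemma min_tableau_Inc: "min_tableau n \<in> Inc (staircase n)"
  by (auto simp: Inc_def min_tableau_def staircase_def ran_def split: if_splits)

lemma staircase_diff: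
  assumes "1 \<le> n"
  shows "staircase n - staircase (n - 1) = (\<lambda>i. (n + 1 - i, i)) ` {1..n}"
  using assms by (auto simp: staircase_def image_iff)

lemma word_tableau_Inc:
  assumes "w \<in> words n" and "1 \<le> n"
  shows "word_tableau w \<in> Inc (staircase n - staircase (n - 1))"
proof -
  have box: "w ! (c - 1) = x \<and> r + c = n + 1 \<and> c - 1 < length w \<and>
      (r, c) \<in> staircase n - staircase (n - 1)"
    if "word_tableau w (r, c) = Some x" for r c x
    using that assms by (auto simp: word_tableau_def words_def staircase_def split: if_splits)
  have "dom (word_tableau w) = staircase n - staircase (n - 1)"
    using assms by (auto simp: word_tableau_def words_def split: if_splits)
  moreover have "0 < x" if "x \<in> ran (word_tableau w)" for x
  proof -
    from that obtain r c where "word_tableau w (r, c) = Some x"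
      by (auto simp: ran_def)
    from box[OF this] have "x \<in> set w"
      using nth_mem by blast
    with assms show ?thesis
      by (simp add: words_def)
  qed
  moreover have "c = c'"
    if "word_tableau w (r, c) = Some x" "word_tableau w (r, c') = Some y" for r c c' x y
    using box[OF that(1)] box[OF that(2)] by linarith
  moreover have "r = r'"
    if "word_tableau w (r, c) = Some x" "word_tableau w (r', c) = Some y" for r r' c x y
    using box[OF that(1)] box[OF that(2)] by linarith
  ultimately show ?thesis
    unfolding Inc_def by blast
qed

lemma word_tableau_nth:
  assumes "1 \<le> i" and "i \<le> length w"
  shows "word_tableau w (length w + 1 - i, i) = Some (w ! (i - 1))"
  using assms by (auto simp: word_tableau_def staircase_def)

end

theory Submission
  imports Defs
begin

text \<open>
  After the letters at most \<open>v\<close> have been used, the tableau with entries \<open>1, \<dots>, n - 1\<close> is a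
  chain of shapes; let \<open>h k t\<close> be the number of boxes of row \<open>k\<close> (counted from 0) of its
  \<open>(t + k)\<close>-th shape that lie to the right of column \<open>t\<close>.  For fixed \<open>v\<close>, the length of a longest
  increasing subsequence of the letters at most \<open>v\<close> in positions \<open>t + 1, \<dots>, n - r\<close> is the
  last passage value
    \<open>max (h 0 s\<^sub>0 - h 0 s\<^sub>1 + h 1 s\<^sub>1 - h 1 s\<^sub>2 + \<dots> + h r s\<^sub>r)\<close>
  over \<open>t = s\<^sub>0 \<le> s\<^sub>1 \<le> \<dots> \<le> s\<^sub>r < n - r\<close>, which depends on the tableau only.  This is proved by
  induction on \<open>v\<close>: one reverse slide moves dots along rows and upwards, and the last passage
  values change exactly as lengths of increasing subsequences do when the letter \<open>v + 1\<close> is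
  admitted.  Decreasing subsequences reduce to increasing ones, since reversing the word
  transposes its tableau.  (The tableau of a word does not determine the tableaux of its factors,
  so there is no induction on the length of the word.)
\<close>

section \<open>Last passage values\<close>

text \<open>The maximum over paths as a recursion: a path either stays in row \<open>k\<close> as
  far as column \<open>t + 1\<close>, or leaves the row at \<open>t\<close>. The default 0 is the
  right value for an empty factor of the word, which is what \<open>n \<le> t + r\<close>
  means.\<close>

function passage :: "nat \<Rightarrow> (nat \<Rightarrow> nat \<Rightarrow> int) \<Rightarrow> nat \<Rightarrow> nat \<Rightarrow> nat \<Rightarrow> int" where
  "passage n h k r t =
     (if r \<le> k then h k t else if n \<le> t + r then 0
      else max (passage n h k r (Suc t) + h k t - h k (Suc t)) (passage n h (Suc k) r t))"
  by auto
termination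
  by (relation "measure (\<lambda>(n, h, k, r, t). (r - k) + (n - t))") auto

declare passage.simps [simp del]

lemma passage_row: "r \<le> k \<Longrightarrow> passage n h k r t = h k t"
  by (simp add: passage.simps)

lemma passage_zero: "k < r \<Longrightarrow> n \<le> t + r \<Longrightarrow> passage n h k r t = 0"
  by (simp add: passage.simps)

lemma passage_rec:
  "k < r \<Longrightarrow> t + r < n \<Longrightarrow>
   passage n h k r t = max (passage n h k r (Suc t) + h k t - h k (Suc t)) (passage n h (Suc k) r t)"
  by (subst passage.simps) simp

lemma passage_cong:
  assumes "\<And>j s. k \<le> j \<Longrightarrow> t \<le> s \<Longrightarrow> h j s = h' j s"
  shows "passage n h k r t = passage n h' k r t"
  using assms
proof (induction n h k r t rule: passage.induct)
  case (1 n h k r t)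
  show ?case
  proof (cases "k < r \<and> t + r < n")
    case True
    then show ?thesis using 1 by (simp add: passage_rec)
  next
    case False
    then show ?thesis using 1(3) by (cases "r \<le> k") (simp_all add: passage_row passage_zero)
  qed
qed

lemma passage_left:
  "t + r < n \<Longrightarrow> passage n h k r (Suc t) + h k t - h k (Suc t) \<le> passage n h k r t"
  by (cases "k < r") (simp_all add: passage_rec passage_row)

lemma passage_up:
  assumes "\<And>k t. n \<le> k + t \<Longrightarrow> h k t = 0" and "k < r"
  shows "passage n h (Suc k) r t \<le> passage n h k r t"
proof (cases "t + r < n")
  case True
  then show ?thesis using assms by (simp add: passage_rec)
next
  case False
  then show ?thesis using assms by (cases "Suc k = r") (simp_all add: passage_zero passage_row)
qed

text \<open>For excesses of row lengths, \<open>h_mono\<close> and \<open>h_jump\<close> say that a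
  row grows by at most one box per entry and never shrinks, and \<open>h_anti\<close> expresses
  strictness down the columns.\<close>

locale profile =
  fixes n :: nat and h :: "nat \<Rightarrow> nat \<Rightarrow> int"
  assumes h_out: "n \<le> k + t \<Longrightarrow> h k t = 0"
    and h_mono: "h k (Suc t) \<le> h k t"
    and h_jump: "h k t \<le> h k (Suc t) + 1"
    and h_anti: "h (Suc k) t \<le> h k t"
begin

abbreviation H where "H \<equiv> passage n h"

lemma h_nonneg: "0 \<le> h k t"
proof (induction "n - t" arbitrary: t rule: less_induct)
  case less
  show ?case
  proof (cases "n \<le> k + t")
    case True
    then show ?thesis by (simp add: h_out)
  next
    case False
    then show ?thesis using less[of "Suc t"] h_mono[of k t] by linarith
  qed
qed

lemma H_nonneg: "0 \<le> H k r t"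
proof (induction "n - t" arbitrary: t rule: less_induct)
  case less
  show ?case
  proof (cases "k < r \<and> t + r < n")
    case True
    then have "0 \<le> H k r (Suc t)" by (intro less) auto
    then show ?thesis using h_mono[of k t] True by (simp add: passage_rec max_def)
  next
    case False
    then show ?thesis by (cases "k < r") (simp_all add: passage_row passage_zero h_nonneg)
  qed
qed

lemma H_le: "H k r t \<le> h k t"
proof (induction "(r - k) + (n - t)" arbitrary: k t rule: less_induct)
  case less
  show ?case
  proof (cases "k < r \<and> t + r < n")
    case True
    then have "H k r (Suc t) \<le> h k (Suc t)" "H (Suc k) r t \<le> h (Suc k) t"
      by (auto intro!: less)
    then show ?thesis using h_anti[of k t] True by (simp add: passage_rec)
  next
    case False
    then show ?thesis by (cases "k < r") (simp_all add: passage_row passage_zero h_nonneg)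
  qed
qed

lemma H_up: "k < r \<Longrightarrow> H (Suc k) r t \<le> H k r t"
  by (rule passage_up) (rule h_out)
lemmas H_left = passage_left[of _ _ n h]

section \<open>Comparison and crossing of paths\<close>

lemma H_source_anti:
  assumes "r1 \<le> r2" "k \<le> r1"
  shows "H k r2 t \<le> H k r1 t"
  using assms
proof (induction "(r2 - k) + (n - t)" arbitrary: k t rule: less_induct)
  case less
  show ?case
  proof (cases "k < r1 \<and> t + r2 < n")
    case True
    then have "H k r2 (Suc t) \<le> H k r1 (Suc t)" "H (Suc k) r2 t \<le> H (Suc k) r1 t"
      using less.prems by (auto intro!: less(1))
    then show ?thesis using True assms(1) by (auto simp: passage_rec)
  next
    case False
    then show ?thesis
      using less.prems H_le[of k r2 t] H_nonneg[of k r1 t]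
      by (cases "k < r1") (simp_all add: passage_row passage_zero)
  qed
qed

text \<open>
  Two paths with interlaced end points cross, and exchanging their tails does not decrease the
  total value.  The recursive proof needs monotonicity of differences at the same time.
\<close>

lemma path_crossing_aux:
  assumes "r1 \<le> r2" "k \<le> r1"
  shows "(\<forall>t t'. t \<le> t' \<and> t' + r2 \<le> n \<longrightarrow> H k r1 t - H k r2 t \<le> H k r1 t' - H k r2 t') \<and>
    (k < r1 \<longrightarrow> (\<forall>t t'. t \<le> t' \<and> t' + r2 \<le> n \<longrightarrow>
       H (Suc k) r1 t - H (Suc k) r2 t \<le> H k r1 t' - H k r2 t'))"
  using assms(2)
proof (induction "r1 - k" arbitrary: k rule: less_induct)
  case (less k)
  have IH: "H (Suc k) r1 t - H (Suc k) r2 t \<le> H (Suc k) r1 t' - H (Suc k) r2 t'"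
    if "k < r1" "t \<le> t'" "t' + r2 \<le> n" for t t'
    using less(1)[of "Suc k"] that by simp
  \<comment> \<open>Induction from the right border inward: of the two branches of
    \<open>H k r2 t'\<close>, the one along the row is covered by the comparison at
    \<open>t' + 1\<close>, the descending one by monotonicity in row \<open>k + 1\<close>.\<close>
  have cross: "H (Suc k) r1 t - H (Suc k) r2 t \<le> H k r1 t' - H k r2 t'"
    if "k < r1" "t \<le> t'" "t' + r2 \<le> n" for t t'
    using that(2,3)
  proof (induction "n - t'" arbitrary: t' rule: less_induct)
    case (less t')
    have mono: "H (Suc k) r1 t - H (Suc k) r2 t \<le> H (Suc k) r1 t' - H (Suc k) r2 t'"
      using \<open>k < r1\<close> less.prems by (intro IH)
    show ?case
    proof (cases "t' + r2 = n")
      case True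
      then show ?thesis
        using mono H_up[OF \<open>k < r1\<close>, of t'] \<open>k < r1\<close> assms(1) h_out[of r2 t']
        by (cases "Suc k = r2") (simp_all add: passage_zero passage_row)
    next
      case False
      then have lt: "t' + r2 < n" "t' + r1 < n"
        using less.prems assms(1) by auto
      have "H (Suc k) r1 t - H (Suc k) r2 t \<le> H k r1 (Suc t') - H k r2 (Suc t')"
        using less.prems lt by (intro less(1)) auto
      then show ?thesis
        using mono H_up[OF \<open>k < r1\<close>, of t'] H_left[OF lt(2), of k] lt \<open>k < r1\<close> assms(1)
        by (simp add: passage_rec[of k r2])
    qed
  qed
  \<comment> \<open>If \<open>H k r1 t\<close> is attained along the row, \<open>H_left\<close> for
    \<open>r2\<close> cancels the same increment; if it is attained by descending,
    \<open>cross\<close> applies with \<open>t' = t + 1\<close>.\<close>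
  have single: "H k r1 t - H k r2 t \<le> H k r1 (Suc t) - H k r2 (Suc t)" if "t + r2 < n" for t
  proof (cases "k < r1")
    case True
    then have "H k r1 t = max (H k r1 (Suc t) + h k t - h k (Suc t)) (H (Suc k) r1 t)"
      using that assms(1) by (intro passage_rec) auto
    then show ?thesis
      using H_left[OF that, of k] H_up[of k r2 t] cross[OF True, of t "Suc t"] True that assms(1)
      by auto
  next
    case False
    then show ?thesis
      using H_left[OF that, of k] less.prems by (simp add: passage_row)
  qed
  have "H k r1 t - H k r2 t \<le> H k r1 t' - H k r2 t'" if "t \<le> t'" "t' + r2 \<le> n" for t t'
    using that
  proof (induction t' rule: dec_induct)
    case base
    then show ?case by simp
  next
    case (step m)
    then show ?case using single[of m] by simp
  qed
  with cross show ?case by blast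
qed

lemma path_crossing:
  assumes "r1 \<le> r2" "k < r1" "t + r2 < n"
  shows "H (Suc k) r1 t + H k r2 (Suc t) \<le> H k r1 (Suc t) + H (Suc k) r2 t"
proof -
  have "H (Suc k) r1 t - H (Suc k) r2 t \<le> H k r1 (Suc t) - H k r2 (Suc t)"
    using path_crossing_aux[of r1 r2 k] assms by auto
  then show ?thesis by simp
qed

text \<open>The crossing inequality with \<open>r1 = k + 1\<close>: the first path then has the full
  value \<open>h (Suc k) t\<close>, and the path it is exchanged with is worth at most
  \<open>h k (Suc t)\<close>.\<close>

lemma deficit_diagonal:
  assumes "k < r" "t + r < n"
  shows "H k r (Suc t) - h k (Suc t) \<le> H (Suc k) r t - h (Suc k) t"
  using path_crossing[of "Suc k" r k t] H_le[of k "Suc k" "Suc t"] assms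
  by (simp add: passage_row)

end

section \<open>The effect of one slide on last passage values\<close>

text \<open>
  \<open>D k t\<close> says that row \<open>k\<close> has a dot once the entries greater than \<open>t + k\<close> have been treated; the
  assumptions are the rules of the slide.  A dot leaves row \<open>Suc k\<close> only by moving up into row
  \<open>k\<close>, as described by \<open>D_drop\<close>.
\<close>

locale dot_step = profile +
  fixes c :: "nat \<Rightarrow> bool" and D :: "nat \<Rightarrow> nat \<Rightarrow> bool"
  assumes source_empty: "c k \<Longrightarrow> k < n \<Longrightarrow> h k (n - Suc k) = 0"
    and D_out: "n \<le> k + t \<Longrightarrow> \<not> D k t"
    and D_source: "Suc (k + t) = n \<Longrightarrow> D k t = c k"
    and D_flat: "Suc (k + t) < n \<Longrightarrow> h k t = h k (Suc t) \<Longrightarrow>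
      D k t \<longleftrightarrow> D k (Suc t) \<or> D (Suc k) t \<and> h (Suc k) t = h k t"
    and D_top: "Suc t < n \<Longrightarrow> h 0 t \<noteq> h 0 (Suc t) \<Longrightarrow> D 0 t \<longleftrightarrow> D 0 (Suc t)"
    and D_drop: "Suc (Suc k + t) < n \<Longrightarrow> h (Suc k) t \<noteq> h (Suc k) (Suc t) \<Longrightarrow>
      D (Suc k) t \<longleftrightarrow> D (Suc k) (Suc t) \<and>
        \<not> (h k (Suc (Suc t)) = h k (Suc t) \<and> h k (Suc t) = h (Suc k) (Suc t))"
begin

section \<open>The profile after the slide\<close>

definition h' where "h' k t = h k t + of_bool (D k t)"

lemma source_zero: "c k \<Longrightarrow> Suc (k + t) = n \<Longrightarrow> h k t = 0"
  using source_empty[of k] by (metis add_diff_cancel_left' diff_Suc_Suc less_add_Suc1)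

text \<open>If both rows dropped together, row \<open>k + 1\<close> would already have its dot at
  \<open>t + 1\<close>, where the rows agree again. By induction row \<open>k\<close> is flat there,
  and this is exactly the situation in which \<open>D_drop\<close> removes that dot from row
  \<open>k + 1\<close>.\<close>

lemma dot_above_flat:
  assumes "D (Suc k) t" "h (Suc k) t = h k t"
  shows "h k t = h k (Suc t)"
  using assms
proof (induction "n - t" arbitrary: t rule: less_induct)
  case less
  have lt: "Suc k + t < n"
    using D_out[of "Suc k" t] less.prems(1) by linarith
  show ?case
  proof (cases "Suc (Suc k + t) = n")
    case True
    then have "h k t = 0"
      using D_source[of "Suc k" t] source_zero[of "Suc k" t] less.prems by simp
    then show ?thesis
      using h_mono[of k t] h_nonneg[of k "Suc t"] by linarith
  next
    case False
    show ?thesis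
    proof (rule ccontr)
      assume "h k t \<noteq> h k (Suc t)"
      then have eq: "h (Suc k) (Suc t) = h k (Suc t)" and ne: "h (Suc k) t \<noteq> h (Suc k) (Suc t)"
        using less.prems(2) h_mono[of k t] h_jump[of k t] h_anti[of k "Suc t"]
          h_jump[of "Suc k" t] by linarith+
      then have D: "D (Suc k) (Suc t)" "\<not> (h k (Suc (Suc t)) = h k (Suc t) \<and> h k (Suc t) = h (Suc k) (Suc t))"
        using D_drop[of k t] less.prems(1) lt False by auto
      then show False
        using less(1)[of "Suc t"] eq lt by simp
    qed
  qed
qed

lemma dot_above:
  assumes "D (Suc k) t" "h (Suc k) t = h k t"
  shows "D k t"
proof -
  have "Suc k + t < n"
    using D_out[of "Suc k" t] assms(1) by linarith
  then show ?thesis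
    using D_flat[of k t] dot_above_flat[OF assms] assms by simp
qed

lemma D_cases:
  assumes "Suc (k + t) < n"
  shows "h k t = h k (Suc t) \<and> (D k (Suc t) \<longrightarrow> D k t) \<or>
    h k t = h k (Suc t) + 1 \<and> (D k t \<longrightarrow> D k (Suc t))"
proof (cases "h k t = h k (Suc t)")
  case True
  then show ?thesis using D_flat[OF assms] by simp
next
  case False
  then have "h k t = h k (Suc t) + 1"
    using h_mono[of k t] h_jump[of k t] by linarith
  then show ?thesis
    using False D_top[of t] D_drop[of "k - 1" t] assms by (cases k) auto
qed

text \<open>By \<open>D_cases\<close> a dot is gained only where its row is flat and lost only where
  it drops, so all steps stay 0 or 1. Rows of equal value stay ordered by
  \<open>dot_above\<close>.\<close>

sublocale new: profile n h'
proof
  show "h' k t = 0" if "n \<le> k + t" for k t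
    using that D_out h_out by (simp add: h'_def)
  have *: "h' k (Suc t) \<le> h' k t \<and> h' k t \<le> h' k (Suc t) + 1" for k t
  proof (cases "Suc (k + t) < n")
    case True
    then show ?thesis using D_cases[OF True] by (auto simp: h'_def)
  next
    case False
    then have "\<not> D k (Suc t)" "h k (Suc t) = 0"
      using D_out[of k "Suc t"] h_out[of k "Suc t"] by simp_all
    moreover have "h k t = 0" if "D k t"
      using that False D_out[of k t] D_source[of k t] source_zero[of k t] by fastforce
    ultimately show ?thesis
      using h_nonneg[of k t] h_jump[of k t] by (auto simp: h'_def)
  qed
  show "h' k (Suc t) \<le> h' k t" "h' k t \<le> h' k (Suc t) + 1" for k t
    using * by blast+
  show "h' (Suc k) t \<le> h' k t" for k t
    using dot_above[of k t] h_anti[of k t]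
    by (cases "h (Suc k) t = h k t") (auto simp: h'_def of_bool_def)
qed

section \<open>Dots that cannot escape\<close>

text \<open>
  Dots of row \<open>k\<close> if none of them could escape into row \<open>k - 1\<close>.  With this idealised row on top
  of the true rows below it, the change of the last passage values can be computed exactly; as row
  0 has no row above it, nothing is idealised there.
\<close>

definition birth where
  "birth k t \<longleftrightarrow> Suc (k + t) = n \<and> c k \<or> D (Suc k) t \<and> h (Suc k) t = h k t"

definition free_dot where "free_dot k t \<longleftrightarrow> (\<exists>s\<ge>t. birth k s)"

lemma free_dot_mono: "free_dot k s \<Longrightarrow> t \<le> s \<Longrightarrow> free_dot k t"
  unfolding free_dot_def using order_trans by blast

lemma free_dot_iff: "free_dot k t \<longleftrightarrow> birth k t \<or> free_dot k (Suc t)"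
  unfolding free_dot_def by (metis Suc_leD le_antisym not_less_eq_eq order_refl)

lemma birth_D: "birth k t \<Longrightarrow> D k t"
  using D_source[of k t] dot_above[of k t] by (auto simp: birth_def)

lemma birth_less: "birth k t \<Longrightarrow> k + t < n"
  using D_out[of "Suc k" t] by (fastforce simp: birth_def)

lemma free_dot_less: "free_dot k t \<Longrightarrow> k + t < n"
  unfolding free_dot_def using birth_less by fastforce

lemma birth_iff:
  assumes "Suc (k + t) < n" "h k t = h k (Suc t)"
  shows "D k t \<longleftrightarrow> D k (Suc t) \<or> birth k t"
  using D_flat[OF assms] assms(1) by (auto simp: birth_def)

lemma D_free_dot: "D k t \<Longrightarrow> free_dot k t"
proof (induction "n - t" arbitrary: t rule: less_induct)
  case less
  have lt: "k + t < n"
    using D_out[of k t] less.prems by linarith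
  show ?case
  proof (cases "Suc (k + t) = n")
    case True
    then show ?thesis
      using D_source[OF True] less.prems by (auto simp: free_dot_def birth_def)
  next
    case False
    then have lt2: "Suc (k + t) < n" using lt by simp
    have "D k (Suc t) \<or> birth k t"
      using D_cases[OF lt2] birth_iff[OF lt2] less.prems by blast
    then show ?thesis
      using less(1)[of "Suc t"] lt2 diff_less_mono2[of t "Suc t" n] free_dot_iff[of k t] by auto
  qed
qed

lemma D_zero_iff: "D 0 t \<longleftrightarrow> free_dot 0 t"
proof
  show "free_dot 0 t \<Longrightarrow> D 0 t"
  proof (induction "n - t" arbitrary: t rule: less_induct)
    case less
    show ?case
    proof (cases "birth 0 t")
      case True
      then show ?thesis by (rule birth_D)
    next
      case False
      then have free_dot: "free_dot 0 (Suc t)"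
        using less.prems free_dot_iff by blast
      then have "Suc t < n" "D 0 (Suc t)"
        using free_dot_less[OF free_dot] less(1)[of "Suc t"] by auto
      then show ?thesis
        using D_flat[of 0 t] D_top[of t] by (cases "h 0 t = h 0 (Suc t)") auto
    qed
  qed
qed (rule D_free_dot)

text \<open>A loss is possible only by the escape clause of \<open>D_drop\<close>, which makes the
  rows agree at \<open>t + 1\<close>; hence the dot is born in row \<open>k\<close> there. When row
  \<open>k + 1\<close> then rises at \<open>t\<close>, \<open>h_anti\<close> forces row
  \<open>k\<close> to rise too.\<close>

lemma lost_dot:
  assumes "\<not> D (Suc k) t" "D (Suc k) (Suc t)"
  shows "birth k (Suc t)" "h (Suc k) t = h (Suc k) (Suc t) + 1" "h k t = h k (Suc t) + 1"
proof -
  have lt: "Suc (Suc k + t) < n"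
    using D_out[of "Suc k" "Suc t"] assms(2) by linarith
  have *: "h (Suc k) t = h (Suc k) (Suc t) + 1"
    using D_cases[OF lt] assms by auto
  then have **: "h k (Suc (Suc t)) = h k (Suc t)" "h k (Suc t) = h (Suc k) (Suc t)"
    using D_drop[OF lt] assms by auto
  show "birth k (Suc t)"
    using ** assms(2) by (simp add: birth_def)
  show "h k t = h k (Suc t) + 1"
    using * ** h_anti[of k t] h_jump[of k t] by linarith
  show "h (Suc k) t = h (Suc k) (Suc t) + 1" by (rule *)
qed

text \<open>To the right of \<open>t\<close> lies a place where the true dot of row
  \<open>k + 1\<close> was lost; \<open>lost_dot\<close> provides a birth in row \<open>k\<close> at
  that place, and free dots persist to the left.\<close>

lemma free_dot_escaped:
  assumes "free_dot (Suc k) t" "\<not> D (Suc k) t"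
  shows "free_dot (Suc k) (Suc t)" "free_dot k t"
proof -
  have *: "free_dot (Suc k) (Suc t)" if "free_dot (Suc k) t" "\<not> D (Suc k) t" for t
    using that free_dot_iff birth_D by blast
  then show "free_dot (Suc k) (Suc t)" using assms by blast
  show "free_dot k t"
    using assms
  proof (induction "n - t" arbitrary: t rule: less_induct)
    case less
    have free_dot: "free_dot (Suc k) (Suc t)" using * less.prems by blast
    show ?case
    proof (cases "D (Suc k) (Suc t)")
      case True
      then show ?thesis
        using lost_dot(1)[OF less.prems(2) True] by (auto simp: free_dot_iff[of k t] free_dot_iff[of k "Suc t"])
    next
      case False
      then have "free_dot k (Suc t)"
        using less(1)[of "Suc t"] free_dot free_dot_less[OF free_dot] by simp
      then show ?thesis using free_dot_mono by simp
    qed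
  qed
qed

section \<open>Last passage values with an idealised top row\<close>

definition free_profile where "free_profile k j t = (if j = k then h k t + of_bool (free_dot k t) else h' j t)"

abbreviation H' where "H' \<equiv> passage n h'"

definition free_passage where "free_passage k = passage n (free_profile k) k"

lemma free_profile_out: "n \<le> j + t \<Longrightarrow> free_profile k j t = 0"
  using free_dot_less[of k t] h_out[of j t] new.h_out[of j t] by (auto simp: free_profile_def)

lemma free_passage_row: "r \<le> k \<Longrightarrow> free_passage k r t = h k t + of_bool (free_dot k t)"
  by (simp add: free_passage_def passage_row free_profile_def)

lemma free_passage_zero: "k < r \<Longrightarrow> n \<le> t + r \<Longrightarrow> free_passage k r t = 0"
  by (simp add: free_passage_def passage_zero)

lemma free_profile_rest: "passage n (free_profile k) (Suc k) r t = H' (Suc k) r t"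
  by (rule passage_cong) (simp add: free_profile_def)

lemma free_passage_rec:
  assumes "k < r" "t + r < n"
  shows "free_passage k r t = max (free_passage k r (Suc t) + (h k t + of_bool (free_dot k t)) - (h k (Suc t) + of_bool (free_dot k (Suc t))))
     (H' (Suc k) r t)"
  unfolding free_passage_def passage_rec[OF assms] free_profile_rest by (simp add: free_profile_def)

lemma free_passage_left:
  "t + r < n \<Longrightarrow> free_passage k r (Suc t) + (h k t + of_bool (free_dot k t)) - (h k (Suc t) + of_bool (free_dot k (Suc t)))
     \<le> free_passage k r t"
  by (cases "k < r") (simp_all add: free_passage_rec free_passage_row)

lemma free_passage_up: "k < r \<Longrightarrow> H' (Suc k) r t \<le> free_passage k r t"
  using passage_up[of n "free_profile k" k r t] free_profile_out by (simp add: free_passage_def free_profile_rest)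

text \<open>The true row can rise faster than the idealised one only where a dot is born anew after
  an escape. There row \<open>k + 1\<close> has a dot and agrees with row \<open>k\<close>, so by
  \<open>deficit_diagonal\<close> the path may descend at \<open>t\<close> without loss.\<close>

lemma H'_le_free_passage: "H' k r t \<le> free_passage k r t"
proof (induction "n - t" arbitrary: t rule: less_induct)
  case less
  show ?case
  proof (cases "k < r \<and> t + r < n")
    case True
    then have IH: "H' k r (Suc t) \<le> free_passage k r (Suc t)"
      by (intro less) auto
    have "H' k r (Suc t) + h' k t - h' k (Suc t) \<le> free_passage k r t"
    proof (cases "D k t \<and> \<not> D k (Suc t) \<and> free_dot k (Suc t)")
      case jump: True
      then have lt: "Suc (k + t) < n"
        using free_dot_less[of k "Suc t"] by simp
      then have "h k t = h k (Suc t)" "D (Suc k) t" "h (Suc k) t = h k t"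
        using jump D_cases[OF lt] birth_iff[OF lt] by (auto simp: birth_def)
      then have "H' k r (Suc t) + h' k t - h' k (Suc t) \<le> H' (Suc k) r t"
        using new.deficit_diagonal[of k r t] True jump by (simp add: h'_def)
      then show ?thesis
        using free_passage_up[of k r t] True by linarith
    next
      case False
      then have "of_bool (D k t) - of_bool (D k (Suc t)) \<le> (of_bool (free_dot k t) - of_bool (free_dot k (Suc t)) :: int)"
        using D_free_dot[of k t] free_dot_mono[of k "Suc t" t] by (auto simp: of_bool_def)
      then show ?thesis
        using IH free_passage_left[of t r k] True by (simp add: h'_def)
    qed
    then show ?thesis
      using free_passage_up[of k r t] True by (simp add: passage_rec)
  next
    case False
    then show ?thesis
      using D_free_dot[of k t]
      by (cases "k < r") (auto simp: passage_zero passage_row free_passage_zero free_passage_row h'_def of_bool_def)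
  qed
qed

text \<open>Moving along row \<open>k\<close> changes neither difference. On descending, both paths
  continue with the same value, from which the idealised row subtracts at least as much.\<close>

lemma free_passage_deficit: "free_passage k r t - (h k t + of_bool (free_dot k t)) \<le> H' k r t - h' k t"
proof (induction "n - t" arbitrary: t rule: less_induct)
  case less
  have le: "h' k t \<le> h k t + of_bool (free_dot k t)"
    using D_free_dot[of k t] by (simp add: h'_def of_bool_def)
  show ?case
  proof (cases "k < r \<and> t + r < n")
    case True
    then have "free_passage k r (Suc t) - (h k (Suc t) + of_bool (free_dot k (Suc t))) \<le> H' k r (Suc t) - h' k (Suc t)"
      by (intro less) auto
    then show ?thesis
      using True le by (auto simp: passage_rec free_passage_rec)
  next
    case False
    then show ?thesis
      using le by (cases "k < r") (auto simp: passage_zero passage_row free_passage_zero free_passage_row)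
  qed
qed

section \<open>Comparison of consecutive idealised rows\<close>

text \<open>
  A path that would profit from an escaped dot can switch to row \<open>k\<close> at the place of the escape,
  where the two rows agree.
\<close>

lemma free_passage_escaped:
  assumes "free_dot (Suc k) t" "\<not> D (Suc k) t" "k < r"
  shows "free_passage (Suc k) r t \<le> max (H' (Suc k) r t) (free_passage k r t - (h k t + 1) + (h (Suc k) t + 1))"
  using assms(1,2)
proof (induction "n - t" arbitrary: t rule: less_induct)
  case less
  show ?case
  proof (cases "t + r < n")
    case False
    then have "Suc k < r"
      using free_dot_less[OF less.prems(1)] assms(3) by auto
    then show ?thesis
      using False by (simp add: free_passage_zero passage_zero)
  next
    case True
    note free_dot = free_dot_escaped[OF less.prems]
    have rec: "free_passage (Suc k) r t \<le> max (free_passage (Suc k) r (Suc t) + h (Suc k) t - h (Suc k) (Suc t)) (H' (Suc k) r t)"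
    proof (cases "Suc k < r")
      case True
      then show ?thesis
        using free_passage_rec[OF True \<open>t + r < n\<close>] new.H_up[OF True, of t] free_dot less.prems by auto
    next
      case False
      then show ?thesis using free_dot less.prems by (simp add: free_passage_row)
    qed
    show ?thesis
    proof (cases "D (Suc k) (Suc t)")
      case lost: True
      have "free_passage (Suc k) r (Suc t) \<le> H' (Suc k) r (Suc t)"
        using free_passage_deficit[of "Suc k" r "Suc t"] lost free_dot by (simp add: h'_def)
      also have "\<dots> \<le> free_passage k r (Suc t)"
        using assms(3) by (rule free_passage_up)
      finally have "free_passage (Suc k) r (Suc t) \<le> free_passage k r (Suc t)" .
      moreover have "free_dot k (Suc t)"
        using lost_dot(1)[OF less.prems(2) lost] by (auto simp: free_dot_def)
      moreover have "h k (Suc t) = h (Suc k) (Suc t)"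
        using lost_dot(1)[OF less.prems(2) lost] free_dot_less[OF free_dot(1)] 
        by (auto simp: birth_def)
      ultimately show ?thesis
        using lost_dot(2,3)[OF less.prems(2) lost] rec free_passage_left[OF True, of k] free_dot by auto
    next
      case False
      have IH: "free_passage (Suc k) r (Suc t) \<le>
          max (H' (Suc k) r (Suc t)) (free_passage k r (Suc t) - (h k (Suc t) + 1) + (h (Suc k) (Suc t) + 1))"
        using True free_dot False by (intro less) auto
      have "free_dot k (Suc t)" using free_dot_escaped(2)[OF free_dot(1) False] .
      then show ?thesis
        using IH rec free_passage_left[OF True, of k] free_dot passage_left[OF True, of h' "Suc k"] False less.prems
        by (auto simp: h'_def)
    qed
  qed
qed

text \<open>Where the free and the true dot of row \<open>k + 1\<close> coincide, the deficit bound
  reduces the claim to a true path in that row. Otherwise the dot has escaped, and the path can be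
  switched to row \<open>k\<close>.\<close>

lemma free_passage_Suc_le:
  assumes "k < r"
  shows "free_passage (Suc k) r t \<le> free_passage k r t"
proof (cases "free_dot (Suc k) t \<and> \<not> D (Suc k) t")
  case True
  then show ?thesis
    using free_passage_escaped[of k t r] assms free_passage_up[OF assms, of t] h_anti[of k t] by auto
next
  case False
  then have "of_bool (free_dot (Suc k) t) = (of_bool (D (Suc k) t) :: int)"
    using D_free_dot by (auto simp: of_bool_def)
  then have "free_passage (Suc k) r t \<le> H' (Suc k) r t"
    using free_passage_deficit[of "Suc k" r t] by (simp add: h'_def)
  then show ?thesis
    using free_passage_up[OF assms, of t] by linarith
qed

text \<open>The idealised value of row \<open>k + 1\<close> lies between its true value and the
  idealised value of row \<open>k\<close>, so it may replace the true one in the maximum. The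
  recursion now contains idealised values only.\<close>

lemma free_passage_rec_free:
  assumes "k < r" "t + r < n"
  shows "free_passage k r t = max (free_passage k r (Suc t) + (h k t + of_bool (free_dot k t)) - (h k (Suc t) + of_bool (free_dot k (Suc t))))
     (free_passage (Suc k) r t)"
  using free_passage_rec[OF assms] free_passage_Suc_le[OF assms(1), of t] H'_le_free_passage[of "Suc k" r t] by linarith

text \<open>The counterpart of the growth criterion for increasing subsequences: a dot that starts
  in row \<open>q\<close> is an occurrence of the new letter, and stopping just before that letter
  costs nothing.\<close>

definition gains where "gains k r t \<longleftrightarrow> (\<exists>q\<ge>r. c q \<and> q + t < n \<and> H k (Suc q) t = H k r t)"

text \<open>Births and persistence of free dots match the recursion for \<open>H k (Suc q)\<close>:
  a source in row \<open>k\<close> itself, a descent where the two rows agree, or an advance along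
  the row.\<close>

lemma free_dot_eq_gains:
  assumes IH: "\<And>t. free_dot (Suc k) t \<longleftrightarrow> gains (Suc k) (Suc k) t"
  shows "free_dot k t \<longleftrightarrow> gains k k t"
proof
  have gains_Suc: "gains k k t" if "gains k k (Suc t)" for t
  proof -
    obtain q where q: "k \<le> q" "c q" "q + Suc t < n" "H k (Suc q) (Suc t) = h k (Suc t)"
      using \<open>gains k k (Suc t)\<close> by (auto simp: gains_def passage_row)
    then have "H k (Suc q) t = h k t"
      using H_left[of t "Suc q" k] H_le[of k "Suc q" t] by simp
    then show ?thesis using q by (auto simp: gains_def passage_row)
  qed
  have birth_gains: "gains k k t" if b: "birth k t" for t
  proof (cases "Suc (k + t) = n \<and> c k")
    case True
    then show ?thesis
      using source_zero[of k t] by (auto simp: gains_def passage_row passage_zero intro!: exI[of _ k])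
  next
    case False
    then have D: "D (Suc k) t" "h (Suc k) t = h k t" using b by (auto simp: birth_def)
    then have "gains (Suc k) (Suc k) t" using IH D_free_dot by blast
    then obtain q where q: "Suc k \<le> q" "c q" "q + t < n" "H (Suc k) (Suc q) t = h (Suc k) t"
      by (auto simp: gains_def passage_row)
    then have "H k (Suc q) t = h k t"
      using H_up[of k "Suc q" t] H_le[of k "Suc q" t] D by simp
    then show ?thesis using q by (auto simp: gains_def passage_row intro!: exI[of _ q])
  qed
  show "free_dot k t \<Longrightarrow> gains k k t"
  proof (induction "n - t" arbitrary: t rule: less_induct)
    case less
    then show ?case
      using free_dot_less[OF less.prems] birth_gains gains_Suc free_dot_iff[of k t] by (metis Suc_lessD Suc_n_not_le_n
        add_lessD1 add.commute diff_less_mono2 lessI)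
  qed
next
  have gains_free_dot: "free_dot k t" if q: "k \<le> q" "c q" "q + t < n" "H k (Suc q) t = h k t" for q t
    using q
  proof (induction "n - t" arbitrary: t rule: less_induct)
    case less
    show ?case
    proof (cases "q = k")
      case True
      then have "birth k (n - Suc k)" "t \<le> n - Suc k" using less.prems by (auto simp: birth_def)
      then show ?thesis by (auto simp: free_dot_def)
    next
      case False
      \<comment> \<open>As \<open>H (Suc k) (Suc q) t \<le> h (Suc k) t \<le> h k t\<close>,
        equality of the ends makes the rows agree. The free dot below is then either a true dot,
        hence a birth in row \<open>k\<close>, or has escaped into row \<open>k\<close>.\<close>
      have *: "free_dot k t" if eq: "H (Suc k) (Suc q) t = h k t"
      proof -
        have eq2: "h (Suc k) t = h k t"
          using eq H_le[of "Suc k" "Suc q" t] h_anti[of k t] by linarith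
        then have "gains (Suc k) (Suc k) t"
          using eq False less.prems by (auto simp: gains_def passage_row intro!: exI[of _ q])
        then have "free_dot (Suc k) t" using IH by blast
        then show ?thesis
          using eq2 free_dot_escaped(2)[of k t] by (auto simp: free_dot_def birth_def)
      qed
      show ?thesis
      proof (cases "t + Suc q < n")
        case True
        then consider "H k (Suc q) (Suc t) = h k (Suc t)" | "H (Suc k) (Suc q) t = h k t"
          using passage_rec[of k "Suc q" t n h] less.prems by (auto simp: max_def split: if_splits)
        then show ?thesis
        proof cases
          case 1
          then have "free_dot k (Suc t)" using less.prems True by (intro less(1)) auto
          then show ?thesis using free_dot_mono by simp
        qed (rule *)
      next
        case False
        then have "H k (Suc q) t = 0" "H (Suc k) (Suc q) t = 0"
          using less.prems \<open>q \<noteq> k\<close> by (simp_all add: passage_zero)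
        then show ?thesis using * less.prems by simp
      qed
    qed
  qed
  show "gains k k t \<Longrightarrow> free_dot k t"
    using gains_free_dot by (auto simp: gains_def passage_row)
qed

text \<open>Induction from the right border, comparing the closed recursion with that of
  \<open>H\<close>. The increments along the row differ only where a free dot first appears, which
  is the delicate case of \<open>upper\<close>.\<close>

lemma free_passage_eq_aux:
  assumes row: "\<And>t. free_dot k t \<longleftrightarrow> gains k k t"
    and IH: "\<And>r t. Suc k \<le> r \<Longrightarrow> free_passage (Suc k) r t = H (Suc k) r t + of_bool (gains (Suc k) r t)"
    and "k \<le> r"
  shows "free_passage k r t = H k r t + of_bool (gains k r t)"
proof (cases "k = r")
  case True
  then show ?thesis using row by (simp add: free_passage_row passage_row)
next
  case False
  then have kr: "k < r" using assms(3) by simp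
  show ?thesis
  proof (induction "n - t" arbitrary: t rule: less_induct)
    case less
    show ?case
    proof (cases "t + r < n")
      case False
      then have "\<not> gains k r t" by (auto simp: gains_def)
      then show ?thesis using False kr by (simp add: free_passage_zero passage_zero)
    next
      case lt: True
      have IHt: "free_passage k r (Suc t) = H k r (Suc t) + of_bool (gains k r (Suc t))"
        using lt by (intro less) simp
      have rec: "free_passage k r t = max (H k r (Suc t) + of_bool (gains k r (Suc t)) +
            (h k t + of_bool (free_dot k t)) - (h k (Suc t) + of_bool (free_dot k (Suc t))))
          (H (Suc k) r t + of_bool (gains (Suc k) r t))"
        using free_passage_rec_free[OF kr lt] IHt IH[of r t] kr by simp
      have recH: "H k r t = max (H k r (Suc t) + h k t - h k (Suc t)) (H (Suc k) r t)"
        using passage_rec[OF kr lt] .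
      have gains_up: "gains k r t" if "gains (Suc k) r t" "H k r t = H (Suc k) r t"
      proof -
        obtain q where q: "r \<le> q" "c q" "q + t < n" "H (Suc k) (Suc q) t = H k r t"
          using \<open>gains (Suc k) r t\<close> \<open>H k r t = H (Suc k) r t\<close> by (auto simp: gains_def)
        then have "H k (Suc q) t = H k r t"
          using H_up[of k "Suc q" t] H_source_anti[of r "Suc q" k t] kr by simp
        then show ?thesis using q by (auto simp: gains_def)
      qed
      have gains_left: "gains k r t" if "gains k r (Suc t)" "H k r t = H k r (Suc t) + h k t - h k (Suc t)"
      proof -
        obtain q where q: "r \<le> q" "c q" "q + Suc t < n" "H k (Suc q) (Suc t) = H k r (Suc t)"
          using \<open>gains k r (Suc t)\<close> by (auto simp: gains_def)
        then have "H k (Suc q) t = H k r t"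
          using H_left[of t "Suc q" k] H_source_anti[of r "Suc q" k t] kr that by simp
        then show ?thesis using q by (auto simp: gains_def)
      qed
      \<comment> \<open>A gain comes with a path to row \<open>q + 1\<close> of the same value as
        the path to row \<open>r\<close>; the branch optimal for the former is optimal for the
        latter and carries the gain along.\<close>
      have lower: "H k r t + of_bool (gains k r t) \<le> free_passage k r t"
      proof (cases "gains k r t")
        case False
        then show ?thesis
          using rec recH free_dot_mono[of k "Suc t" t] by (auto simp: of_bool_def)
      next
        case True
        then obtain q where q: "r \<le> q" "c q" "q + t < n" "H k (Suc q) t = H k r t"
          by (auto simp: gains_def)
        have up: ?thesis if "H (Suc k) (Suc q) t = H k r t"
        proof -
          have "H (Suc k) r t = H k r t"
            using that H_source_anti[of r "Suc q" "Suc k" t] H_up[OF kr, of t] q kr by simp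
          then have "gains (Suc k) r t" using q that by (auto simp: gains_def)
          then show ?thesis using rec \<open>H (Suc k) r t = H k r t\<close> True by simp
        qed
        show ?thesis
        proof (cases "t + Suc q < n")
          case True
          then consider "H k r t = H k (Suc q) (Suc t) + h k t - h k (Suc t)" | "H (Suc k) (Suc q) t = H k r t"
            using passage_rec[of k "Suc q" t n h] q kr by (auto simp: max_def split: if_splits)
          then show ?thesis
          proof cases
            case 1
            then have eq: "H k (Suc q) (Suc t) = H k r (Suc t)"
              using recH H_source_anti[of r "Suc q" k "Suc t"] q kr by simp
            then have "gains k r (Suc t)" using q True by (auto simp: gains_def)
            then show ?thesis
              using rec 1 eq \<open>gains k r t\<close> free_dot_mono[of k "Suc t" t] by (auto simp: of_bool_def)
          qed (rule up)
        next
          case False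
          then show ?thesis using up q kr by (simp add: passage_zero)
        qed
      qed
      have upper: "free_passage k r t \<le> H k r t + of_bool (gains k r t)"
      proof -
        have "H (Suc k) r t + of_bool (gains (Suc k) r t) \<le> H k r t + of_bool (gains k r t)"
          using recH gains_up by (cases "H k r t = H (Suc k) r t") (auto simp: of_bool_def)
        moreover have "H k r (Suc t) + of_bool (gains k r (Suc t)) +
            (h k t + of_bool (free_dot k t)) - (h k (Suc t) + of_bool (free_dot k (Suc t))) \<le>
          H k r t + of_bool (gains k r t)" (is "?L \<le> ?R")
        proof (cases "free_dot k t \<and> \<not> free_dot k (Suc t)")
          case False
          then have "?L = H k r (Suc t) + of_bool (gains k r (Suc t)) + h k t - h k (Suc t)"
            using free_dot_mono[of k "Suc t" t] by (auto simp: of_bool_def)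
          then show ?thesis
            using recH gains_left
            by (cases "H k r t = H k r (Suc t) + h k t - h k (Suc t)") (auto simp: of_bool_def)
        next
          case jump: True
          \<comment> \<open>A free dot that first appears at \<open>t\<close> means that some source
            attains the full row value at \<open>t\<close>, while none does at
            \<open>t + 1\<close>.\<close>
          then obtain q where q: "k \<le> q" "c q" "q + t < n" "H k (Suc q) t = h k t"
            using row by (auto simp: gains_def passage_row)
          have not_gains: "H k (Suc p) (Suc t) < h k (Suc t)" if "k \<le> p" "c p" "p + Suc t < n" for p
            using jump row that H_le[of k "Suc p" "Suc t"] by (fastforce simp: gains_def passage_row)
          show ?thesis
          proof (cases "r \<le> q")
            \<comment> \<open>Here the path to row \<open>r\<close> attains the full row value as
              well, so the extra unit is a gain at \<open>t\<close>. A gain at \<open>t + 1\<close>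
              only fills up a unit missing there.\<close>
            case True
            then have "H k r t = h k t"
              using q H_source_anti[of r "Suc q" k t] H_le[of k r t] kr by simp
            then have "gains k r t" using q True by (auto simp: gains_def)
            moreover have "H k r (Suc t) < h k (Suc t)" if "gains k r (Suc t)"
            proof -
              obtain p where "r \<le> p" "c p" "p + Suc t < n" "H k (Suc p) (Suc t) = H k r (Suc t)"
                using \<open>gains k r (Suc t)\<close> by (auto simp: gains_def)
              then show ?thesis using not_gains[of p] kr by simp
            qed
            ultimately show ?thesis
              using jump \<open>H k r t = h k t\<close> H_le[of k r "Suc t"] by (auto simp: of_bool_def)
          next
            case False
            then have lt2: "t + Suc q < n" using lt by simp
            have eq: "H (Suc k) (Suc q) t = h k t"
              using passage_rec[of k "Suc q" t n h] q lt2 not_gains[of q] by (auto simp: max_def split: if_splits)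
            \<comment> \<open>Crossing with the path to row \<open>q + 1\<close>, which is strictly
              deficient at \<open>t + 1\<close> but not below at \<open>t\<close>, makes descending
              better by at least one. This absorbs the new dot.\<close>
            have cross: "H k (Suc p) (Suc t) + h k t - h k (Suc t) + 1 \<le> H (Suc k) (Suc p) t"
              if "q \<le> p" "p + Suc t < n" for p
              using path_crossing[of "Suc q" "Suc p" k t] that eq not_gains[of q] q by simp
            have le: "H k r (Suc t) + h k t - h k (Suc t) + 1 \<le> H (Suc k) r t"
              using cross[of "r - 1"] False lt by simp
            \<comment> \<open>The bound is at risk only if the estimate \<open>le\<close> is tight
              and there is a gain at \<open>t + 1\<close>; crossing for its source \<open>p\<close>
              then yields a gain at \<open>t\<close>.\<close>
            show ?thesis
            proof (cases "gains k r (Suc t) \<and> H k r t = H k r (Suc t) + h k t - h k (Suc t) + 1")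
              case True
              then obtain p where p: "r \<le> p" "c p" "p + Suc t < n" "H k (Suc p) (Suc t) = H k r (Suc t)"
                by (auto simp: gains_def)
              then have "H k r t \<le> H (Suc k) (Suc p) t"
                using cross[of p] True False by simp
              then have "H k (Suc p) t = H k r t"
                using H_up[of k "Suc p" t] H_source_anti[of r "Suc p" k t] p kr by simp
              then have "gains k r t" using p by (auto simp: gains_def)
              then show ?thesis using True jump by simp
            next
              case False
              then show ?thesis using le H_up[OF kr, of t] jump by (auto simp: of_bool_def)
            qed
          qed
        qed
        ultimately show ?thesis using rec by simp
      qed
      from lower upper show ?thesis by simp
    qed
  qed
qed

text \<open>Induction on \<open>k\<close> downwards from \<open>n\<close>, where all values vanish.
  The identity for row \<open>k + 1\<close> with \<open>r = k + 1\<close> is the description of its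
  free dots that the step to row \<open>k\<close> requires.\<close>

lemma free_passage_eq: "k \<le> r \<Longrightarrow> free_passage k r t = H k r t + of_bool (gains k r t)"
proof (induction "n - k" arbitrary: k r t rule: less_induct)
  case less
  show ?case
  proof (cases "k < n")
    case True
    have IH: "free_passage (Suc k) r t = H (Suc k) r t + of_bool (gains (Suc k) r t)" if "Suc k \<le> r" for r t
      using True that by (intro less) auto
    have "free_dot (Suc k) t \<longleftrightarrow> gains (Suc k) (Suc k) t" for t
      using IH[of "Suc k" t] by (simp add: free_passage_row passage_row of_bool_def split: if_splits)
    from free_passage_eq_aux[OF free_dot_eq_gains[OF this] IH less.prems] show ?thesis by blast
  next
    case False
    then have "\<not> gains k r t" "\<not> free_dot k t"
      using less.prems free_dot_less[of k t] by (auto simp: gains_def)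
    then show ?thesis
      using False less.prems by (cases "k = r") (simp_all add: free_passage_row passage_row free_passage_zero passage_zero)
  qed
qed

text \<open>Nothing escapes from row 0, so for \<open>k = 0\<close> the idealised profile is the
  true one.\<close>

lemma passage_step:
  "passage n h' 0 r t = passage n h 0 r t +
     of_bool (\<exists>q\<ge>r. c q \<and> q + t < n \<and> passage n h 0 (Suc q) t = passage n h 0 r t)"
proof -
  have "passage n h' 0 r t = free_passage 0 r t"
    unfolding free_passage_def by (rule passage_cong) (simp add: free_profile_def h'_def D_zero_iff)
  then show ?thesis using free_passage_eq[of 0 r t] by (simp add: gains_def)
qed

end

section \<open>Reverse slides as motion of dots\<close>

text \<open>
  \<open>f k i\<close> is the length of row \<open>k + 1\<close> of the shape formed by the entries at most \<open>i\<close> together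
  with the boxes removed from the inner shape.
\<close>

definition encodes :: "nat \<Rightarrow> (nat \<Rightarrow> nat \<Rightarrow> nat) \<Rightarrow> tableau \<Rightarrow> bool" where
  "encodes N f T \<longleftrightarrow> (\<forall>b x. T b = Some x \<longleftrightarrow>
     (\<exists>k. b = (Suc k, f k x) \<and> 1 \<le> x \<and> x \<le> N \<and> f k x = Suc (f k (x - 1))))"

definition unit_steps :: "nat \<Rightarrow> (nat \<Rightarrow> nat \<Rightarrow> nat) \<Rightarrow> bool" where
  "unit_steps N f \<longleftrightarrow> (\<forall>k i. 1 \<le> i \<and> i \<le> N \<longrightarrow> f k i = f k (i - 1) \<or> f k i = Suc (f k (i - 1)))"

text \<open>A dot of row \<open>k\<close> always stands in column \<open>f k i + 1\<close>, so its
  row suffices; \<open>m\<close> counts the entries treated, from \<open>N\<close> downwards. A row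
  containing the current entry keeps its dot or receives one from directly below; any other row
  keeps its dot unless the entry stands directly above it.\<close>

primrec dots_down :: "nat \<Rightarrow> (nat \<Rightarrow> nat \<Rightarrow> nat) \<Rightarrow> (nat \<Rightarrow> bool) \<Rightarrow> nat \<Rightarrow> nat \<Rightarrow> bool" where
  "dots_down N f c 0 = c"
| "dots_down N f c (Suc m) = (\<lambda>k.
     if f k (N - m) = Suc (f k (N - m - 1))
     then dots_down N f c m k \<or> dots_down N f c m (Suc k) \<and> Suc (f (Suc k) (N - m)) = f k (N - m)
     else dots_down N f c m k \<and>
       \<not> (\<exists>j. k = Suc j \<and> f j (N - m) = Suc (f j (N - m - 1)) \<and> f j (N - m) = Suc (f k (N - m))))"

definition dots :: "nat \<Rightarrow> (nat \<Rightarrow> nat \<Rightarrow> nat) \<Rightarrow> (nat \<Rightarrow> bool) \<Rightarrow> nat \<Rightarrow> nat \<Rightarrow> bool" where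
  "dots N f c k i = dots_down N f c (N - i) k"

lemma dots_top: "dots N f c k N = c k"
  by (simp add: dots_def)

lemma dots_pred:
  assumes "1 \<le> i" "i \<le> N"
  shows "dots N f c k (i - 1) \<longleftrightarrow>
    (if f k i = Suc (f k (i - 1))
     then dots N f c k i \<or> dots N f c (Suc k) i \<and> Suc (f (Suc k) i) = f k i
     else dots N f c k i \<and>
       \<not> (\<exists>j. k = Suc j \<and> f j i = Suc (f j (i - 1)) \<and> f j i = Suc (f k i)))"
proof -
  have "N - (i - 1) = Suc (N - i)" "N - (N - i) = i"
    using assms by auto
  then show ?thesis
    unfolding dots_def by simp
qed

text \<open>A box that is a dot once the entries above \<open>i\<close> have been treated finally
  holds an entry at most \<open>i\<close> or is vacated. It therefore counts towards the new shape
  with index \<open>i\<close>.\<close>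

definition slid :: "nat \<Rightarrow> (nat \<Rightarrow> nat \<Rightarrow> nat) \<Rightarrow> (nat \<Rightarrow> bool) \<Rightarrow> nat \<Rightarrow> nat \<Rightarrow> nat" where
  "slid N f c k i = f k i + of_bool (dots N f c k i)"

lemma slid_unit_steps:
  assumes "unit_steps N f"
  shows "unit_steps N (slid N f c)"
  unfolding unit_steps_def
proof (intro allI impI)
  fix k i assume i: "1 \<le> i \<and> i \<le> N"
  then have "f k i = f k (i - 1) \<or> f k i = Suc (f k (i - 1))"
    using assms unfolding unit_steps_def by blast
  moreover have "dots N f c k i \<longrightarrow> dots N f c k (i - 1)" if "f k i = Suc (f k (i - 1))"
    using that i dots_pred[of i N f c k] by simp
  moreover have "dots N f c k (i - 1) \<longrightarrow> dots N f c k i" if "f k i = f k (i - 1)"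
    using that i dots_pred[of i N f c k] by simp
  ultimately show "slid N f c k i = slid N f c k (i - 1) \<or> slid N f c k i = Suc (slid N f c k (i - 1))"
    by (auto simp: slid_def of_bool_def)
qed

text \<open>The loop invariant of a slide. Entries above \<open>i\<close> are already in final
  position because each step moves only dots and copies of its own entry.\<close>

definition dotted :: "nat \<Rightarrow> (nat \<Rightarrow> nat \<Rightarrow> nat) \<Rightarrow> (nat \<Rightarrow> bool) \<Rightarrow> nat \<Rightarrow> (box \<rightharpoonup> cell) \<Rightarrow> bool" where
  "dotted N f c i F \<longleftrightarrow>
     (\<forall>b. F b = Some Dot \<longleftrightarrow> (\<exists>k. b = (Suc k, Suc (f k i)) \<and> dots N f c k i)) \<and>
     (\<forall>b x. F b = Some (Entry x) \<longleftrightarrow> 1 \<le> x \<and> x \<le> N \<and>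
       (if x \<le> i then \<exists>k. b = (Suc k, f k x) \<and> f k x = Suc (f k (x - 1))
        else \<exists>k. b = (Suc k, slid N f c k x) \<and> slid N f c k x = Suc (slid N f c k (x - 1))))"

abbreviation "above_or_left \<equiv> (\<lambda>d b. below_or_right b d)"

section \<open>One simultaneous exchange of dots and entries\<close>

lemma swap_dots_Dot:
  "swap_dots R i F b = Some Dot \<longleftrightarrow>
     F b = Some Dot \<and> \<not> (\<exists>b'. R b b' \<and> F b' = Some (Entry i)) \<or>
     F b = Some (Entry i) \<and> (\<exists>d. R d b \<and> F d = Some Dot)"
  by (auto simp: swap_dots_def)

lemma swap_dots_Entry:
  "swap_dots R i F b = Some (Entry x) \<longleftrightarrow>
     x = i \<and> F b = Some Dot \<and> (\<exists>b'. R b b' \<and> F b' = Some (Entry i)) \<or>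
     F b = Some (Entry x) \<and> \<not> (x = i \<and> (\<exists>d. R d b \<and> F d = Some Dot))"
  by (auto simp: swap_dots_def)

lemma below_or_right_to:
  "below_or_right b (Suc r, Suc c) \<longleftrightarrow> b = (r, Suc c) \<or> b = (Suc r, c)"
  by (cases b) (auto simp: below_or_right_def)

lemma below_or_right_from: "below_or_right (r, c) b \<longleftrightarrow> b = (Suc r, c) \<or> b = (r, Suc c)"
  by (auto simp: below_or_right_def)

text \<open>Expressed by row lengths, the neighbour conditions of the exchange
  (\<open>nb_dot\<close>, \<open>nb_entry\<close>) become the case distinction of
  \<open>dots_pred\<close>.\<close>

lemma dotted_swap:
  assumes "dotted N f c i F" and i: "1 \<le> i" "i \<le> N" and "unit_steps N f"
  shows "dotted N f c (i - 1) (swap_dots above_or_left i F)"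
proof -
  let ?D = "dots N f c"
  define up where "up k \<longleftrightarrow> (\<exists>j. k = Suc j \<and> f j i = Suc (f j (i - 1)) \<and> f j i = Suc (f k i))" for k
  have step: "f k i = f k (i - 1) \<or> f k i = Suc (f k (i - 1))" for k
    using assms by (simp add: unit_steps_def)
  have Dot: "F b = Some Dot \<longleftrightarrow> (\<exists>k. b = (Suc k, Suc (f k i)) \<and> ?D k i)" for b
    using assms(1) unfolding dotted_def by blast
  have Entry: "F b = Some (Entry x) \<longleftrightarrow> 1 \<le> x \<and> x \<le> N \<and>
       (if x \<le> i then \<exists>k. b = (Suc k, f k x) \<and> f k x = Suc (f k (x - 1))
        else \<exists>k. b = (Suc k, slid N f c k x) \<and> slid N f c k x = Suc (slid N f c k (x - 1)))" for b x
    using assms(1) unfolding dotted_def by blast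
  have Entry_i: "F b = Some (Entry i) \<longleftrightarrow> (\<exists>k. b = (Suc k, f k i) \<and> f k i = Suc (f k (i - 1)))" for b
    using i by (simp add: Entry)
  have nb_dot: "(\<exists>b'. below_or_right b' (Suc k, Suc (f k i)) \<and> F b' = Some (Entry i)) \<longleftrightarrow>
      f k i = Suc (f k (i - 1)) \<or>
      up k" for k
    unfolding below_or_right_to Entry_i up_def by auto
  have nb_entry: "(\<exists>d. below_or_right (Suc k, f k i) d \<and> F d = Some Dot) \<longleftrightarrow>
      ?D k i \<or> ?D (Suc k) i \<and> Suc (f (Suc k) i) = f k i" for k
    unfolding below_or_right_from Dot by auto
  note pred = dots_pred[OF i, of f c, folded up_def]
  have 1: "swap_dots above_or_left i F b = Some Dot \<longleftrightarrow>
      (\<exists>k. b = (Suc k, Suc (f k (i - 1))) \<and> ?D k (i - 1))" for b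
  proof -
    have "swap_dots above_or_left i F b = Some Dot \<longleftrightarrow>
       (\<exists>k. b = (Suc k, Suc (f k i)) \<and> ?D k i \<and>
          \<not> (f k i = Suc (f k (i - 1)) \<or>
             up k)) \<or>
       (\<exists>k. b = (Suc k, f k i) \<and> f k i = Suc (f k (i - 1)) \<and>
          (?D k i \<or> ?D (Suc k) i \<and> Suc (f (Suc k) i) = f k i))"
      unfolding swap_dots_Dot Dot[of b] Entry_i[of b] nb_dot[symmetric] nb_entry[symmetric] by blast
    also have "\<dots> \<longleftrightarrow> (\<exists>k. b = (Suc k, Suc (f k (i - 1))) \<and> ?D k (i - 1))"
      unfolding ex_disj_distrib[symmetric]
    proof (rule ex_cong1)
      fix k
      show "(b = (Suc k, Suc (f k i)) \<and> ?D k i \<and>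
          \<not> (f k i = Suc (f k (i - 1)) \<or>
             up k)) \<or>
        b = (Suc k, f k i) \<and> f k i = Suc (f k (i - 1)) \<and>
          (?D k i \<or> ?D (Suc k) i \<and> Suc (f (Suc k) i) = f k i) \<longleftrightarrow>
        (b = (Suc k, Suc (f k (i - 1))) \<and> ?D k (i - 1))"
        using step[of k] pred[of k]
        by (cases "f k i = Suc (f k (i - 1))"; cases "?D k i") simp_all
    qed
    finally show ?thesis .
  qed
  have 2: "swap_dots above_or_left i F b = Some (Entry i) \<longleftrightarrow>
      (\<exists>k. b = (Suc k, slid N f c k i) \<and> slid N f c k i = Suc (slid N f c k (i - 1)))" for b
  proof -
    have "swap_dots above_or_left i F b = Some (Entry i) \<longleftrightarrow>
       (\<exists>k. b = (Suc k, Suc (f k i)) \<and> ?D k i \<and>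
          (f k i = Suc (f k (i - 1)) \<or>
             up k)) \<or>
       (\<exists>k. b = (Suc k, f k i) \<and> f k i = Suc (f k (i - 1)) \<and>
          \<not> (?D k i \<or> ?D (Suc k) i \<and> Suc (f (Suc k) i) = f k i))"
      unfolding swap_dots_Entry Dot[of b] Entry_i[of b] nb_dot[symmetric] nb_entry[symmetric] by blast
    also have "\<dots> \<longleftrightarrow>
      (\<exists>k. b = (Suc k, slid N f c k i) \<and> slid N f c k i = Suc (slid N f c k (i - 1)))"
      unfolding ex_disj_distrib[symmetric]
    proof (rule ex_cong1)
      fix k
      show "(b = (Suc k, Suc (f k i)) \<and> ?D k i \<and>
          (f k i = Suc (f k (i - 1)) \<or>
             up k) \<or>
        b = (Suc k, f k i) \<and> f k i = Suc (f k (i - 1)) \<and>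
          \<not> (?D k i \<or> ?D (Suc k) i \<and> Suc (f (Suc k) i) = f k i)) \<longleftrightarrow>
        (b = (Suc k, slid N f c k i) \<and> slid N f c k i = Suc (slid N f c k (i - 1)))"
        using step[of k] pred[of k]
        by (cases "f k i = Suc (f k (i - 1))"; cases "?D k i"; cases "?D k (i - 1)")
          (simp_all add: slid_def)
    qed
    finally show ?thesis .
  qed
  have 3: "swap_dots above_or_left i F b = Some (Entry x) \<longleftrightarrow> F b = Some (Entry x)" if "x \<noteq> i" for b x
    using that by (simp add: swap_dots_Entry)
  show ?thesis
    unfolding dotted_def
  proof (intro conjI allI)
    show "swap_dots above_or_left i F b = Some Dot \<longleftrightarrow>
      (\<exists>k. b = (Suc k, Suc (f k (i - 1))) \<and> ?D k (i - 1))" for b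
      by (rule 1)
    show "swap_dots above_or_left i F b = Some (Entry x) \<longleftrightarrow> 1 \<le> x \<and> x \<le> N \<and>
       (if x \<le> i - 1 then \<exists>k. b = (Suc k, f k x) \<and> f k x = Suc (f k (x - 1))
        else \<exists>k. b = (Suc k, slid N f c k x) \<and> slid N f c k x = Suc (slid N f c k (x - 1)))" for b x
    proof (cases "x = i")
      case True
      moreover have "\<not> i \<le> i - 1" using i by simp
      ultimately show ?thesis using i 2[of b] by simp
    next
      case False
      then have "x \<le> i - 1 \<longleftrightarrow> x \<le> i" using i by auto
      then show ?thesis using 3[OF False] Entry by simp
    qed
  qed
qed

section \<open>A complete reverse slide\<close>

lemma fold_down_invariant:
  assumes "P N x" and "\<And>i y. 1 \<le> i \<Longrightarrow> i \<le> N \<Longrightarrow> P i y \<Longrightarrow> P (i - 1) (g i y)"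
  shows "P 0 (fold g (rev [1..<Suc N]) x)"
  using assms
proof (induction N arbitrary: x)
  case (Suc N)
  have "P N (g (Suc N) x)"
    using Suc.prems(2)[of "Suc N" x] Suc.prems(1) by simp
  then have "P 0 (fold g (rev [1..<Suc N]) (g (Suc N) x))"
    using Suc.prems(2) by (intro Suc.IH) auto
  then show ?case by simp
qed simp

lemma fold_trivial: "(\<And>i. i \<in> set xs \<Longrightarrow> g i x = x) \<Longrightarrow> fold g xs x = x"
  by (induction xs) auto

lemma encodes_le:
  assumes "encodes N f T" "T b = Some x"
  shows "x \<le> N"
  using assms unfolding encodes_def by blast

lemma unit_steps_mono:
  assumes "unit_steps N f" "i \<le> j" "j \<le> N"
  shows "f k i \<le> f k j"
  using assms(2,3)
proof (induction j rule: dec_induct)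
  case (step m)
  then show ?case using assms(1)[unfolded unit_steps_def, rule_format, of "Suc m" k] by auto
qed simp

text \<open>The slide starts at the largest entry present, the encoding at the fixed bound
  \<open>N\<close>. Steps for entries that do not occur are the identity, so the loop may as well
  start at \<open>N\<close>.\<close>

lemma rjdt_encodes:
  assumes T: "encodes N f T" and steps: "unit_steps N f"
    and C: "\<And>b. b \<in> C \<longleftrightarrow> (\<exists>k. b = (Suc k, Suc (f k N)) \<and> c k)"
  shows "encodes N (slid N f c) (rjdt C T)"
proof -
  let ?g = "swap_dots above_or_left" and ?F = "put_dots C T"
  have Tb: "T b = Some x \<longleftrightarrow>
     (\<exists>k. b = (Suc k, f k x) \<and> 1 \<le> x \<and> x \<le> N \<and> f k x = Suc (f k (x - 1)))" for b x
    using T unfolding encodes_def by blast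
  have notC: "b \<notin> C" if "T b = Some x" for b x
  proof
    assume "b \<in> C"
    then obtain k where "b = (Suc k, Suc (f k N))" using C by blast
    moreover obtain j where "b = (Suc j, f j x)" "x \<le> N" using \<open>T b = Some x\<close> Tb by blast
    ultimately show False using unit_steps_mono[OF steps, of x N k] by auto
  qed
  have "dotted N f c N ?F"
    unfolding dotted_def
  proof (intro conjI allI)
    show "?F b = Some Dot \<longleftrightarrow> (\<exists>k. b = (Suc k, Suc (f k N)) \<and> dots N f c k N)" for b
      using C by (auto simp: put_dots_def dots_top)
    have "?F b = Some (Entry x) \<longleftrightarrow> T b = Some x" for b x
      using notC[of b x] by (auto simp: put_dots_def)
    then show "?F b = Some (Entry x) \<longleftrightarrow> 1 \<le> x \<and> x \<le> N \<and>
       (if x \<le> N then \<exists>k. b = (Suc k, f k x) \<and> f k x = Suc (f k (x - 1))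
        else \<exists>k. b = (Suc k, slid N f c k x) \<and> slid N f c k x = Suc (slid N f c k (x - 1)))" for b x
      unfolding Tb by (simp, blast)
  qed
  then have dotted0: "dotted N f c 0 (fold ?g (rev [1..<Suc N]) ?F)"
    using dotted_swap steps by (intro fold_down_invariant[of "dotted N f c"])
  define m where "m = max_entry T"
  have ranT: "ran T \<subseteq> {..N}"
    using encodes_le[OF T] by (auto simp: ran_def)
  then have fin: "finite (ran T)" using finite_subset by blast
  have le: "x \<le> m" if "T b = Some x" for b x
    using fin that by (auto simp: m_def max_entry_def intro!: Max_ge ranI)
  have mN: "m \<le> N"
    using ranT fin by (auto simp: m_def max_entry_def)
  have id: "?g i ?F = ?F" if "m < i" for i
  proof -
    have no: "?F b \<noteq> Some (Entry i)" for b
      using that le[of b i] by (auto simp: put_dots_def)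
    then show ?thesis by (simp add: swap_dots_def fun_eq_iff)
  qed
  have split: "rev [1..<Suc N] = rev [Suc m..<Suc N] @ rev [1..<Suc m]"
    using mN upt_add_eq_append[of 1 "Suc m" "N - m"] by (simp flip: rev_append)
  have "fold ?g (rev [Suc m..<Suc N]) ?F = ?F"
    by (rule fold_trivial) (auto intro: id)
  then have "fold ?g (rev [1..<Suc N]) ?F = fold ?g (rev [1..<Suc m]) ?F"
    unfolding split fold_append by simp
  then have "rjdt C T = delete_dots (fold ?g (rev [1..<Suc N]) ?F)"
    by (simp add: rjdt_def m_def)
  moreover have "delete_dots F b = Some x \<longleftrightarrow> F b = Some (Entry x)" for F b x
    by (auto simp: delete_dots_def split: option.splits cell.splits)
  ultimately show ?thesis
    using dotted0 unfolding encodes_def dotted_def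
    by (simp only: not_one_le_zero le_zero_eq) (metis le_zero_eq not_one_le_zero)
qed

section \<open>Increasing subsequences with bounded letters\<close>

definition lis_upto :: "nat \<Rightarrow> nat list \<Rightarrow> nat" where
  "lis_upto v xs = Max (length ` {s. subseq s xs \<and> sorted_wrt (<) s \<and> (\<forall>x \<in> set s. x \<le> v)})"

lemma finite_subseqs: "finite {s. subseq s xs \<and> P s}"
  by (rule finite_subset[of _ "set (subseqs xs)"]) auto

lemma lis_upto_ge:
  "subseq s xs \<Longrightarrow> sorted_wrt (<) s \<Longrightarrow> \<forall>x \<in> set s. x \<le> v \<Longrightarrow> length s \<le> lis_upto v xs"
  unfolding lis_upto_def by (rule Max_ge) (auto intro: finite_subseqs)

lemma lis_upto_witness:
  obtains s where "subseq s xs" "sorted_wrt (<) s" "\<forall>x \<in> set s. x \<le> v" "length s = lis_upto v xs"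
proof -
  let ?S = "length ` {s. subseq s xs \<and> sorted_wrt (<) s \<and> (\<forall>x \<in> set s. x \<le> v)}"
  have "[] \<in> {s. subseq s xs \<and> sorted_wrt (<) s \<and> (\<forall>x \<in> set s. x \<le> v)}" by simp
  then have "?S \<noteq> {}" by blast
  then have "Max ?S \<in> ?S" by (intro Max_in) (auto intro: finite_subseqs)
  then show thesis using that by (auto simp: lis_upto_def)
qed

lemma subseq_set: "subseq s xs \<Longrightarrow> set s \<subseteq> set xs"
  by (induction rule: list_emb.induct) auto

lemma subseq_rev: "subseq s xs \<Longrightarrow> subseq (rev s) (rev xs)"
proof (induction rule: list_emb.induct)
  case (list_emb_Cons xs ys y)
  then show ?case by (simp add: subseq_rev_drop_many)
next
  case (list_emb_Cons2 x y xs ys)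
  then show ?case by simp
qed simp

lemma subseq_rev_conv: "subseq s (rev xs) \<longleftrightarrow> subseq (rev s) xs"
  using subseq_rev[of s "rev xs"] subseq_rev[of "rev s" xs] by auto

lemma lis_upto_eq_lis:
  assumes "\<forall>x \<in> set xs. x \<le> v"
  shows "lis_upto v xs = lis xs"
proof -
  have "\<forall>x \<in> set s. x \<le> v" if "subseq s xs" for s
    using assms subseq_set[OF that] by blast
  then have "{s. subseq s xs \<and> sorted_wrt (<) s \<and> (\<forall>x \<in> set s. x \<le> v)} =
      {s. subseq s xs \<and> sorted_wrt (<) s}" by blast
  then show ?thesis by (simp add: lis_upto_def lis_def)
qed

lemma lis_upto_0:
  assumes "\<forall>x \<in> set xs. 0 < x"
  shows "lis_upto 0 xs = 0"
proof -
  obtain s where s: "subseq s xs" "\<forall>x \<in> set s. x \<le> (0::nat)" "length s = lis_upto 0 xs"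
    by (rule lis_upto_witness)
  then have "set s \<subseteq> set xs" using subseq_set by blast
  then have "s = []" using s(2) assms by (cases s) auto
  then show ?thesis using s by simp
qed

section \<open>Admitting one more letter value\<close>

lemma subseq_snocD:
  assumes "subseq (s @ [a]) xs"
  obtains p where "p < length xs" "xs ! p = a" "subseq s (take p xs)"
proof -
  obtain us vs where xs: "xs = us @ vs" "subseq s us" "subseq [a] vs"
    using assms list_emb_appendD by metis
  then have "a \<in> set vs" by (simp add: subseq_singleton_left)
  then obtain i where i: "i < length vs" "vs ! i = a" by (metis in_set_conv_nth)
  show thesis
    using i xs by (intro that[of "length us + i"]) (auto simp: nth_append)
qed

lemma subseq_snocI:
  assumes "p < length xs" "subseq s (take p xs)"
  shows "subseq (s @ [xs ! p]) xs"
proof -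
  have "subseq (s @ [xs ! p]) (take p xs @ drop p xs)"
    using assms by (intro list_emb_append_mono) (auto simp flip: Cons_nth_drop_Suc)
  then show ?thesis by simp
qed

lemma lis_upto_take: "lis_upto v (take p xs) \<le> lis_upto v xs"
proof -
  obtain s where s: "subseq s (take p xs)" "sorted_wrt (<) s" "\<forall>x \<in> set s. x \<le> v"
    "length s = lis_upto v (take p xs)" by (rule lis_upto_witness)
  have "subseq (take p xs) xs" by (metis append_take_drop_id subseq_rev_drop_many subseq_order.order_refl)
  then show ?thesis using s lis_upto_ge[of s xs v] subseq_order.order_trans by metis
qed

text \<open>The letter \<open>v + 1\<close> can only come last in such a sequence; without it, the
  sequence lies in the prefix before an occurrence. So the maximum grows, by one, exactly if some
  such prefix already attains it.\<close>

lemma lis_upto_Suc: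
  "lis_upto (Suc v) xs = lis_upto v xs +
     of_bool (\<exists>p < length xs. xs ! p = Suc v \<and> lis_upto v (take p xs) = lis_upto v xs)"
proof (rule antisym)
  obtain s where s: "subseq s xs" "sorted_wrt (<) s" "\<forall>x \<in> set s. x \<le> Suc v"
    "length s = lis_upto (Suc v) xs" by (rule lis_upto_witness)
  show "lis_upto (Suc v) xs \<le> lis_upto v xs +
     of_bool (\<exists>p < length xs. xs ! p = Suc v \<and> lis_upto v (take p xs) = lis_upto v xs)"
  proof (cases "Suc v \<in> set s")
    case False
    then have "\<forall>x \<in> set s. x \<le> v" using s(3) le_Suc_eq by auto
    then have "lis_upto (Suc v) xs \<le> lis_upto v xs"
      using lis_upto_ge[OF s(1,2)] s(4) by simp
    then show ?thesis by simp
  next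
    case True
    then obtain s' a where s': "s = s' @ [a]" by (cases s rule: rev_cases) auto
    have a: "a = Suc v" "\<forall>x \<in> set s'. x \<le> v" "sorted_wrt (<) s'"
      using True s(2,3) unfolding s' by (fastforce simp: sorted_wrt_append)+
    obtain p where p: "p < length xs" "xs ! p = a" "subseq s' (take p xs)"
      using s(1) unfolding s' by (rule subseq_snocD)
    have "length s' \<le> lis_upto v (take p xs)"
      using lis_upto_ge[OF p(3)] a by blast
    then have "lis_upto (Suc v) xs \<le> Suc (lis_upto v (take p xs))"
      using s(4) s' by simp
    then show ?thesis
      using p a lis_upto_take[of v p xs] by (cases "lis_upto v (take p xs) = lis_upto v xs") auto
  qed
next
  have "lis_upto v xs \<le> lis_upto (Suc v) xs"
  proof -
    obtain s where s: "subseq s xs" "sorted_wrt (<) s" "\<forall>x \<in> set s. x \<le> v" "length s = lis_upto v xs"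
      by (rule lis_upto_witness)
    then have "\<forall>x \<in> set s. x \<le> Suc v" by auto
    then show ?thesis using lis_upto_ge[OF s(1,2)] s(4) by simp
  qed
  moreover have "Suc (lis_upto v xs) \<le> lis_upto (Suc v) xs"
    if p: "p < length xs" "xs ! p = Suc v" "lis_upto v (take p xs) = lis_upto v xs" for p
  proof -
    obtain s where s: "subseq s (take p xs)" "sorted_wrt (<) s" "\<forall>x \<in> set s. x \<le> v"
      "length s = lis_upto v (take p xs)" by (rule lis_upto_witness)
    have "length (s @ [Suc v]) \<le> lis_upto (Suc v) xs"
      using subseq_snocI[OF p(1) s(1)] s(2,3) p(2)
      by (intro lis_upto_ge) (auto simp: sorted_wrt_append le_SucI less_Suc_eq_le)
    then show ?thesis using s(4) p(3) by simp
  qed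
  ultimately show "lis_upto v xs +
     of_bool (\<exists>p < length xs. xs ! p = Suc v \<and> lis_upto v (take p xs) = lis_upto v xs)
     \<le> lis_upto (Suc v) xs"
    by (auto simp: of_bool_def)
qed

lemma lds_rev: "lds (rev xs) = lis xs"
proof -
  have "{s. subseq s (rev xs) \<and> sorted_wrt (>) s} = rev ` {s. subseq s xs \<and> sorted_wrt (<) s}"
  proof (intro equalityI subsetI)
    fix s assume "s \<in> {s. subseq s (rev xs) \<and> sorted_wrt (>) s}"
    then show "s \<in> rev ` {s. subseq s xs \<and> sorted_wrt (<) s}"
      by (intro image_eqI[of _ _ "rev s"]) (auto simp: sorted_wrt_rev subseq_rev_conv)
  qed (auto simp: sorted_wrt_rev subseq_rev_conv)
  then show ?thesis by (simp add: lds_def lis_def image_image)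
qed

section \<open>Transposition\<close>

lemma max_entry_transpose: "max_entry (T \<circ> prod.swap) = max_entry T"
proof -
  have "range (T \<circ> prod.swap) = range T" by (metis fun.set_map surj_swap)
  then have "ran (T \<circ> prod.swap) = ran T" unfolding ran_def by (metis (no_types, lifting) image_iff rangeI)
  then show ?thesis by (simp add: max_entry_def)
qed

lemma below_or_right_transpose [simp]: "below_or_right (prod.swap a) (prod.swap b) = below_or_right a b"
  by (cases a; cases b) (auto simp: below_or_right_def)

lemma swap_dots_transpose:
  "swap_dots above_or_left i (F \<circ> prod.swap) = swap_dots above_or_left i F \<circ> prod.swap"
proof -
  have "(\<exists>b'. below_or_right b' b \<and> F (prod.swap b') = y) \<longleftrightarrow>
      (\<exists>b'. below_or_right b' (prod.swap b) \<and> F b' = y)" for b y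
    by (metis below_or_right_transpose swap_swap)
  moreover have "(\<exists>b'. below_or_right b b' \<and> F (prod.swap b') = y) \<longleftrightarrow>
      (\<exists>b'. below_or_right (prod.swap b) b' \<and> F b' = y)" for b y
    by (metis below_or_right_transpose swap_swap)
  ultimately show ?thesis
    by (simp add: swap_dots_def fun_eq_iff)
qed

lemma rjdt_transpose: "rjdt (prod.swap ` C) (T \<circ> prod.swap) = rjdt C T \<circ> prod.swap"
proof -
  have "fold (swap_dots above_or_left) xs (F \<circ> prod.swap) = fold (swap_dots above_or_left) xs F \<circ> prod.swap"
    for xs F
    by (induction xs arbitrary: F) (simp_all add: swap_dots_transpose)
  moreover have "put_dots (prod.swap ` C) (T \<circ> prod.swap) = put_dots C T \<circ> prod.swap"
    by (auto simp: put_dots_def fun_eq_iff image_iff)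
  moreover have "delete_dots (F \<circ> prod.swap) = delete_dots F \<circ> prod.swap" for F
    by (simp add: delete_dots_def fun_eq_iff)
  ultimately show ?thesis
    by (simp add: rjdt_def max_entry_transpose)
qed

lemma rjdt_tableau_transpose:
  "rjdt_tableau (U \<circ> prod.swap) (T \<circ> prod.swap) = rjdt_tableau U T \<circ> prod.swap"
proof -
  have "boxes_of (U \<circ> prod.swap) i = prod.swap ` boxes_of U i" for i
    by (force simp: boxes_of_def)
  then have "fold (\<lambda>i. rjdt (boxes_of (U \<circ> prod.swap) i)) xs (T \<circ> prod.swap) =
      fold (\<lambda>i. rjdt (boxes_of U i)) xs T \<circ> prod.swap" for xs
    by (induction xs arbitrary: T) (simp_all add: rjdt_transpose)
  then show ?thesis by (simp add: rjdt_tableau_def max_entry_transpose)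
qed

text \<open>Reversal transposes the antidiagonal of letters, the minimal tableau is symmetric, and
  reverse slides commute with transposition.\<close>

lemma word_M_rev: "word_M (rev w) = word_M w \<circ> prod.swap"
proof -
  have "min_tableau n \<circ> prod.swap = min_tableau n" for n
    by (auto simp: min_tableau_def staircase_def fun_eq_iff)
  moreover have "word_tableau (rev w) = word_tableau w \<circ> prod.swap"
  proof -
    have "word_tableau (rev w) (r, c) = word_tableau w (c, r)" for r c
    proof (cases "(r, c) \<in> staircase (length w) - staircase (length w - 1)")
      case True
      then have "(c, r) \<in> staircase (length w) - staircase (length w - 1)" "r + c = Suc (length w)" "1 \<le> r" "1 \<le> c"
        by (auto simp: staircase_def)
      moreover from this have "rev w ! (c - 1) = w ! (r - 1)"
        by (subst rev_nth) (auto intro: arg_cong[of _ _ "(!) w"])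
      ultimately show ?thesis using True by (simp add: word_tableau_def)
    next
      case False
      then have "(c, r) \<notin> staircase (length w) - staircase (length w - 1)"
        by (auto simp: staircase_def)
      then show ?thesis using False by (simp add: word_tableau_def)
    qed
    then show ?thesis by auto
  qed
  ultimately show ?thesis
    using rjdt_tableau_transpose[of "word_tableau w" "min_tableau (length w - 1)"]
    by (simp add: word_M_def infusion_def)
qed

section \<open>Longest increasing subsequences from the tableau\<close>

text \<open>The index \<open>t + k\<close> aligns the rows so that strictness down the columns
  becomes \<open>h_anti\<close>; subtracting \<open>t\<close> makes the excess of the minimal
  tableau vanish.\<close>

definition excess :: "nat \<Rightarrow> (nat \<Rightarrow> nat \<Rightarrow> nat) \<Rightarrow> nat \<Rightarrow> nat \<Rightarrow> int" where
  "excess n f k t = (if k + t < n then int (f k (t + k)) - int t else 0)"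

lemma dot_step_excess:
  assumes "profile n (excess n f)" and steps: "unit_steps (n - 1) f"
    and c: "\<And>k. c k \<Longrightarrow> k < n \<Longrightarrow> f k (n - 1) = n - 1 - k"
  defines "D \<equiv> \<lambda>k t. k + t < n \<and> dots (n - 1) f c k (t + k)"
  shows "dot_step n (excess n f) c D" and "excess n (slid (n - 1) f c) = dot_step.h' (excess n f) D"
proof -
  interpret profile n "excess n f" by fact
  have ex: "excess n f k t = int (f k (t + k)) - int t" if "k + t < n" for k t
    using that by (simp add: excess_def)
  have pred: "dots (n - 1) f c k (t + k) \<longleftrightarrow>
    (if f k (Suc (t + k)) = Suc (f k (t + k))
     then dots (n - 1) f c k (Suc (t + k)) \<or>
       dots (n - 1) f c (Suc k) (Suc (t + k)) \<and> Suc (f (Suc k) (Suc (t + k))) = f k (Suc (t + k))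
     else dots (n - 1) f c k (Suc (t + k)) \<and>
       \<not> (\<exists>j. k = Suc j \<and> f j (Suc (t + k)) = Suc (f j (t + k)) \<and> f j (Suc (t + k)) = Suc (f k (Suc (t + k)))))"
    if "Suc (k + t) < n" for k t
    using dots_pred[of "Suc (t + k)" "n - 1" f c k] that by simp
  \<comment> \<open>The subtraction of \<open>t\<close> reverses the roles: the excess is flat where
    the row gains a box with entry \<open>t + k + 1\<close>, and drops where it does not.\<close>
  have ex_flat: "excess n f k t = excess n f k (Suc t) \<longleftrightarrow> f k (Suc (t + k)) = Suc (f k (t + k))"
    if "Suc (k + t) < n" for k t
    using that ex[of k t] ex[of k "Suc t"] by auto
  show "dot_step n (excess n f) c D"
  proof unfold_locales
    show "excess n f k (n - Suc k) = 0" if "c k" "k < n" for k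
      using that c[OF that] by (simp add: excess_def)
    show "\<not> D k t" if "n \<le> k + t" for k t
      using that by (simp add: D_def)
    show "D k t = c k" if "Suc (k + t) = n" for k t
      using that by (auto simp: D_def dots_top add.commute)
    show "D k t \<longleftrightarrow> D k (Suc t) \<or> D (Suc k) t \<and> excess n f (Suc k) t = excess n f k t"
      if lt: "Suc (k + t) < n" and eq: "excess n f k t = excess n f k (Suc t)" for k t
    proof -
      have "excess n f (Suc k) t = excess n f k t \<longleftrightarrow> Suc (f (Suc k) (Suc (t + k))) = f k (Suc (t + k))"
        using lt eq ex[of "Suc k" t] ex[of k "Suc t"] by auto
      then show ?thesis
        using lt eq pred[OF lt] ex_flat[OF lt] by (simp add: D_def)
    qed
    show "D 0 t \<longleftrightarrow> D 0 (Suc t)" if "Suc t < n" "excess n f 0 t \<noteq> excess n f 0 (Suc t)" for t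
      using that pred[of 0 t] ex_flat[of 0 t] by (simp add: D_def)
    show "D (Suc k) t \<longleftrightarrow> D (Suc k) (Suc t) \<and>
        \<not> (excess n f k (Suc (Suc t)) = excess n f k (Suc t) \<and>
           excess n f k (Suc t) = excess n f (Suc k) (Suc t))"
      if lt: "Suc (Suc k + t) < n" and ne: "excess n f (Suc k) t \<noteq> excess n f (Suc k) (Suc t)" for k t
    proof -
      have "excess n f k (Suc (Suc t)) = excess n f k (Suc t) \<longleftrightarrow>
          f k (Suc (t + Suc k)) = Suc (f k (t + Suc k))"
        using lt ex_flat[of k "Suc t"] by auto
      moreover have "excess n f k (Suc t) = excess n f (Suc k) (Suc t) \<longleftrightarrow>
          f k (t + Suc k) = f (Suc k) (Suc (t + Suc k))"
        using lt ex[of k "Suc t"] ex[of "Suc k" "Suc t"] by auto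
      ultimately show ?thesis
        using lt ne pred[OF lt] ex_flat[OF lt] by (auto simp: D_def)
    qed
  qed
  then interpret dot_step n "excess n f" c D .
  show "excess n (slid (n - 1) f c) = h'"
  proof (intro ext)
    fix k t
    have "h' k t = excess n f k t + of_bool (D k t)" by (rule h'_def)
    moreover have "D k t \<longleftrightarrow> k + t < n \<and> dots (n - 1) f c k (t + k)" by (simp only: D_def)
    ultimately show "excess n (slid (n - 1) f c) k t = h' k t"
      by (cases "k + t < n") (simp_all add: excess_def slid_def)
  qed
qed

section \<open>Induction over the letter values\<close>

lemma passage_const_0: "passage n (\<lambda>_ _. 0) k r t = 0"
proof (induction "(r - k) + (n - t)" arbitrary: k t rule: less_induct)
  case less
  show ?case
  proof (cases "k < r \<and> t + r < n")
    case True
    then have "passage n (\<lambda>_ _. 0) k r (Suc t) = 0" "passage n (\<lambda>_ _. 0) (Suc k) r t = 0"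
      by (auto intro!: less)
    then show ?thesis using True by (simp add: passage_rec)
  qed (cases "k < r", simp_all add: passage_row passage_zero)
qed

definition tracks :: "nat list \<Rightarrow> nat \<Rightarrow> tableau \<Rightarrow> (nat \<Rightarrow> nat \<Rightarrow> nat) \<Rightarrow> bool" where
  "tracks w v T f \<longleftrightarrow> (let n = length w in
     encodes (n - 1) f T \<and> unit_steps (n - 1) f \<and> profile n (excess n f) \<and>
     (\<forall>k<n. f k (n - 1) = n - 1 - k + of_bool (w ! (n - 1 - k) \<le> v)) \<and>
     (\<forall>r t. passage n (excess n f) 0 r t = int (lis_upto v (drop t (take (n - r) w)))))"

lemma tracksD:
  assumes "tracks w v T f" "length w = n"
  shows "encodes (n - 1) f T" "unit_steps (n - 1) f" "profile n (excess n f)"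
    "k < n \<Longrightarrow> f k (n - 1) = n - 1 - k + of_bool (w ! (n - 1 - k) \<le> v)"
    "passage n (excess n f) 0 r t = int (lis_upto v (drop t (take (n - r) w)))"
  using assms by (simp_all add: tracks_def Let_def)

text \<open>Row \<open>k + 1\<close> of the minimal tableau starts with the entry
  \<open>k + 1\<close>; truncated subtraction leaves it empty for \<open>i \<le> k\<close>.\<close>

lemma tracks_init:
  assumes "w \<in> words n" "1 \<le> n"
  shows "tracks w 0 (min_tableau (n - 1)) (\<lambda>k i. i - k)"
proof -
  have n: "length w = n" and pos: "\<forall>x \<in> set w. 0 < x"
    using assms by (auto simp: words_def)
  have "encodes (n - 1) (\<lambda>k i. i - k) (min_tableau (n - 1))"
    unfolding encodes_def
  proof (intro allI)
    fix b :: box and x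
    obtain r c where b: "b = (r, c)" by (cases b)
    show "min_tableau (n - 1) b = Some x \<longleftrightarrow>
        (\<exists>k. b = (Suc k, x - k) \<and> 1 \<le> x \<and> x \<le> n - 1 \<and> x - k = Suc (x - 1 - k))"
      unfolding b by (cases r) (auto simp: min_tableau_def staircase_def)
  qed
  moreover have "unit_steps (n - 1) (\<lambda>k i. i - k)"
    unfolding unit_steps_def by auto
  moreover have ex: "excess n (\<lambda>k i. i - k) = (\<lambda>_ _. 0)"
    by (auto simp: excess_def fun_eq_iff)
  moreover have "profile n (\<lambda>_ _. 0)" by unfold_locales auto
  moreover have "n - 1 - k = n - 1 - k + of_bool (w ! (n - 1 - k) \<le> 0)" if "k < n" for k
  proof -
    have "w ! (n - 1 - k) \<in> set w" using that n by simp
    then show ?thesis using pos by force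
  qed
  moreover have "lis_upto 0 (drop t (take r w)) = 0" for r t
    using pos by (intro lis_upto_0) (meson in_set_dropD in_set_takeD)
  ultimately show ?thesis
    unfolding tracks_def n Let_def by (simp only: passage_const_0) simp
qed

lemma word_tableau_boxes:
  assumes "length w = n" "1 \<le> n"
  shows "b \<in> boxes_of (word_tableau w) v \<longleftrightarrow> (\<exists>k<n. b = (Suc k, n - k) \<and> w ! (n - 1 - k) = v)"
proof -
  obtain r c where b: "b = (r, c)" by (cases b)
  have "(r, c) \<in> staircase n - staircase (n - 1) \<longleftrightarrow> (\<exists>k<n. r = Suc k \<and> c = n - k)"
    using assms(2) by (cases r) (auto simp: staircase_def)
  then show ?thesis
    using assms(1) by (auto simp: b boxes_of_def word_tableau_def)
qed

text \<open>\<open>passage_step\<close> and \<open>lis_upto_Suc\<close> describe the same growth: a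
  dot starting in row \<open>q\<close> is the occurrence of \<open>v + 1\<close> at index
  \<open>n - 1 - q\<close> of the word.\<close>

lemma tracks_step:
  assumes "tracks w v T f" and n: "length w = n" "1 \<le> n"
    and c: "\<And>k. c k \<longleftrightarrow> k < n \<and> w ! (n - 1 - k) = Suc v"
  shows "tracks w (Suc v) (rjdt (boxes_of (word_tableau w) (Suc v)) T) (slid (n - 1) f c)"
proof -
  have T: "encodes (n - 1) f T" and steps: "unit_steps (n - 1) f" and prof: "profile n (excess n f)"
    and top: "\<And>k. k < n \<Longrightarrow> f k (n - 1) = n - 1 - k + of_bool (w ! (n - 1 - k) \<le> v)"
    and pas: "\<And>r t. passage n (excess n f) 0 r t = int (lis_upto v (drop t (take (n - r) w)))"
    using tracksD[OF assms(1) n(1)] by simp_all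
  define D where "D = (\<lambda>k t. k + t < n \<and> dots (n - 1) f c k (t + k))"
  have c_top: "f k (n - 1) = n - 1 - k" if "c k" for k
    using that top[of k] c[of k] by simp
  note ds = dot_step_excess[of n f c, OF prof steps c_top, folded D_def]
  interpret dot_step n "excess n f" c D by (rule ds(1))
  have ex': "excess n (slid (n - 1) f c) = h'" by (rule ds(2))
  have "encodes (n - 1) (slid (n - 1) f c) (rjdt (boxes_of (word_tableau w) (Suc v)) T)"
  proof (rule rjdt_encodes[OF T steps])
    show "b \<in> boxes_of (word_tableau w) (Suc v) \<longleftrightarrow> (\<exists>k. b = (Suc k, Suc (f k (n - 1))) \<and> c k)" for b
    proof -
      have "k < n \<and> b = (Suc k, n - k) \<and> w ! (n - 1 - k) = Suc v \<longleftrightarrow>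
          b = (Suc k, Suc (f k (n - 1))) \<and> c k" for k
      proof (cases "c k")
        case True
        then have "Suc (f k (n - 1)) = n - k" using c_top[OF True] c[of k] by (simp add: Suc_diff_Suc)
        then show ?thesis using True c[of k] by simp
      next
        case False
        then show ?thesis using c[of k] by blast
      qed
      then show ?thesis
        unfolding word_tableau_boxes[OF n] by blast
    qed
  qed
  moreover have "profile n h'" by (rule new.profile_axioms)
  moreover have "slid (n - 1) f c k (n - 1) = n - 1 - k + of_bool (w ! (n - 1 - k) \<le> Suc v)" if "k < n" for k
    using top[OF that] that c[of k] by (simp add: slid_def dots_top le_Suc_eq)
  moreover have "passage n h' 0 r t = int (lis_upto (Suc v) (drop t (take (n - r) w)))" for r t
  proof -
    let ?xs = "drop t (take (n - r) w)"
    have iff: "(\<exists>q\<ge>r. c q \<and> q + t < n \<and> passage n (excess n f) 0 (Suc q) t = passage n (excess n f) 0 r t)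
      \<longleftrightarrow> (\<exists>p < length ?xs. ?xs ! p = Suc v \<and> lis_upto v (take p ?xs) = lis_upto v ?xs)" (is "?L \<longleftrightarrow> ?R")
    proof
      assume ?L
      then obtain q where q: "r \<le> q" "c q" "q + t < n"
        "lis_upto v (drop t (take (n - Suc q) w)) = lis_upto v ?xs"
        unfolding pas by auto
      have idx: "n - Suc q - t < length ?xs" "t + (n - Suc q - t) = n - Suc q"
        using q n by auto
      moreover have "take (n - Suc q - t) ?xs = drop t (take (n - Suc q) w)"
        using q by (simp add: take_drop min_def)
      ultimately show ?R
        using q c[of q] n by (intro exI[of _ "n - Suc q - t"]) simp
    next
      assume ?R
      then obtain p where p: "p < length ?xs" "?xs ! p = Suc v" "lis_upto v (take p ?xs) = lis_upto v ?xs"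
        by blast
      \<comment> \<open>Index \<open>p\<close> of the factor is index \<open>t + p\<close> of the
        word, whose letter lies in row \<open>q\<close>.\<close>
      define q where "q = n - Suc (t + p)"
      have lt: "t + p < n - r" using p(1) n by simp
      then have q: "r \<le> q" "q + t < n" "n - 1 - q = t + p" "n - Suc q = t + p"
        using n by (auto simp: q_def)
      have "w ! (t + p) = Suc v" using p(2) lt n by simp
      then have "c q" using q n c[of q] by simp
      moreover have "take p ?xs = drop t (take (n - Suc q) w)"
        using q lt by (simp add: take_drop min_def add.commute)
      ultimately show ?L using q p(3) unfolding pas by auto
    qed
    have "passage n h' 0 r t = passage n (excess n f) 0 r t + of_bool ?L"
      by (rule passage_step)
    also have "\<dots> = int (lis_upto v ?xs) + of_bool ?R"
      by (subst iff) (simp only: pas)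
    also have "\<dots> = int (lis_upto (Suc v) ?xs)"
      by (simp only: lis_upto_Suc of_nat_add of_nat_of_bool)
    finally show ?thesis .
  qed
  ultimately show ?thesis
    using slid_unit_steps[OF steps, of c] unfolding tracks_def n(1) Let_def ex' by blast
qed

lemma tracks_word_M:
  assumes w: "w \<in> words n" "1 \<le> n"
  obtains f m where "tracks w m (word_M w) f" "\<forall>x \<in> set w. x \<le> m"
proof -
  have n: "length w = n" using w by (simp add: words_def)
  let ?U = "word_tableau w"
  let ?step = "\<lambda>i. rjdt (boxes_of ?U i)"
  have "\<exists>f. tracks w v (fold ?step [1..<Suc v] (min_tableau (n - 1))) f" for v
  proof (induction v)
    case 0
    then show ?case using tracks_init[OF w] by auto
  next
    case (Suc v)
    then obtain f where "tracks w v (fold ?step [1..<Suc v] (min_tableau (n - 1))) f" ..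
    from tracks_step[OF this n w(2), of "\<lambda>k. k < n \<and> w ! (n - 1 - k) = Suc v"]
    show ?case by auto
  qed
  then obtain f where f: "tracks w (max_entry ?U) (word_M w) f"
    by (auto simp: word_M_def infusion_def rjdt_tableau_def n)
  have "ran ?U \<subseteq> set w"
  proof
    fix x assume "x \<in> ran ?U"
    then obtain r c where "?U (r, c) = Some x" by (auto simp: ran_def)
    then have "x = w ! (c - 1)" "c - 1 < length w"
      using n w(2) by (auto simp: word_tableau_def staircase_def split: if_splits)
    then show "x \<in> set w" by simp
  qed
  then have fin: "finite (ran ?U)" using finite_subset by blast
  have "x \<le> max_entry ?U" if x: "x \<in> set w" for x
  proof -
    obtain i where i: "i < length w" "w ! i = x" using x by (auto simp: in_set_conv_nth)
    then have "?U (length w + 1 - Suc i, Suc i) = Some x"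
      using word_tableau_nth[of "Suc i" w] by simp
    then have "x \<in> ran ?U" by (rule ranI)
    then show ?thesis using fin by (simp add: max_entry_def)
  qed
  with f show thesis using that by blast
qed

text \<open>Row \<open>k\<close> grows at index \<open>i + 1\<close> exactly if it contains the
  entry \<open>i + 1\<close>, so its lengths can be read off downwards from the last one.\<close>

lemma encodes_unique:
  assumes "encodes N f T" "encodes N g T" "unit_steps N f" "unit_steps N g"
    and "f k N = g k N" "i \<le> N"
  shows "f k i = g k i"
  using assms(6)
proof (induction "N - i" arbitrary: i)
  case 0
  then show ?case using assms(5) by simp
next
  case (Suc m)
  then have i: "1 \<le> Suc i" "Suc i \<le> N" by auto
  have IH: "f k (Suc i) = g k (Suc i)" using Suc by simp
  have row: "f' k (Suc i) = Suc (f' k i) \<longleftrightarrow> (\<exists>c. T (Suc k, c) = Some (Suc i))"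
    if "encodes N f' T" for f'
    using that i unfolding encodes_def by auto
  have "f k (Suc i) = f k i \<or> f k (Suc i) = Suc (f k i)" "g k (Suc i) = g k i \<or> g k (Suc i) = Suc (g k i)"
    using assms(3,4) i unfolding unit_steps_def by fastforce+
  then show ?case
    using IH row[OF assms(1)] row[OF assms(2)] by auto
qed

lemma lis_determined:
  assumes u: "u \<in> words n" and w: "w \<in> words n" and n: "1 \<le> n" and M: "word_M u = word_M w"
    and j: "j \<le> n"
  shows "lis (factor i j u) = lis (factor i j w)"
proof -
  have len: "length u = n" "length w = n" using u w by (auto simp: words_def)
  obtain f a where f: "tracks u a (word_M u) f" "\<forall>x \<in> set u. x \<le> a"
    by (rule tracks_word_M[OF u n])
  obtain g b where g: "tracks w b (word_M w) g" "\<forall>x \<in> set w. x \<le> b"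
    by (rule tracks_word_M[OF w n])
  note f1 = tracksD[OF f(1) len(1), unfolded M] and g1 = tracksD[OF g(1) len(2)]
  have top: "f k (n - 1) = g k (n - 1)" if "k < n" for k
  proof -
    have "u ! (n - 1 - k) \<le> a" "w ! (n - 1 - k) \<le> b"
      using f(2) g(2) that len by simp_all
    then show ?thesis using f1(4)[OF that] g1(4)[OF that] by simp
  qed
  have "excess n f k t = excess n g k t" for k t
  proof (cases "k + t < n")
    case True
    then have "f k (t + k) = g k (t + k)"
      by (intro encodes_unique[OF f1(1) g1(1) f1(2) g1(2) top]) simp_all
    then show ?thesis by (simp add: excess_def)
  qed (simp add: excess_def)
  then have eq: "excess n f = excess n g" by (simp add: fun_eq_iff)
  \<comment> \<open>The parameters \<open>r = n - j\<close> and \<open>t = i - 1\<close> cut out the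
    factor from \<open>i\<close> to \<open>j\<close>. The bounds \<open>a\<close> and
    \<open>b\<close> may differ, but each exceeds or equals all letters of its word.\<close>
  from f1(5)[of "n - j" "i - 1"] g1(5)[of "n - j" "i - 1"] have "lis_upto a (drop (i - 1) (take (n - (n - j)) u)) = lis_upto b (drop (i - 1) (take (n - (n - j)) w))"
    by (simp only: eq of_nat_eq_iff)
  moreover have "\<forall>x \<in> set (factor i j u). x \<le> a" "\<forall>x \<in> set (factor i j w). x \<le> b"
    using f(2) g(2) unfolding factor_def by (meson in_set_dropD in_set_takeD)+
  ultimately show ?thesis
    using j lis_upto_eq_lis[of "factor i j u" a] lis_upto_eq_lis[of "factor i j w" b]
    by (simp add: factor_def)
qed

theorem theorem2p14:
  fixes n :: nat and u w :: "nat list"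
  assumes "n \<ge> 1" and "u \<in> words n" and "w \<in> words n"
    and "word_M u = word_M w"
  shows "cid_equiv n u w"
proof -
  \<comment> \<open>Reversal sends the positions from \<open>i\<close> to \<open>j\<close> to those
    from \<open>n + 1 - j\<close> to \<open>n + 1 - i\<close> and turns decreasing subsequences into
    increasing ones.\<close>
  have lds: "lds (factor i j x) = lis (factor (n + 1 - j) (n + 1 - i) (rev x))"
    if "x \<in> words n" "1 \<le> i" "i \<le> j" "j \<le> n" for i j x
  proof -
    have "length x = n" using that by (simp add: words_def)
    moreover have "j - (i - Suc 0) = Suc j - i" using that by simp
    ultimately have "factor i j x = rev (factor (n + 1 - j) (n + 1 - i) (rev x))"
      using that by (simp add: factor_def rev_take rev_drop drop_take)
    then show ?thesis by (simp add: lds_rev)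
  qed
  have "rev u \<in> words n" "rev w \<in> words n" "word_M (rev u) = word_M (rev w)"
    using assms by (simp_all add: words_def word_M_rev)
  note rev = lis_determined[OF this(1,2) assms(1) this(3)]
  show ?thesis
    unfolding cid_equiv_def
  proof (intro allI impI)
    fix i j assume ij: "1 \<le> i \<and> i \<le> j \<and> j \<le> n"
    then have "lds (factor i j u) = lds (factor i j w)"
      using lds[of u i j] lds[of w i j] assms(2,3) rev[of "n + 1 - i" "n + 1 - j"] ij
        le_diff_conv[of "Suc n" i n] by simp
    then show "lis (factor i j u) = lis (factor i j w) \<and> lds (factor i j u) = lds (factor i j w)"
      using lis_determined[OF assms(2,3,1,4)] ij by simp
  qed
qed

end
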